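(* Let $\mathcal{L}$ be a logic having the parallel interpolation property (PIP), and let $\mathcal{D}$ be a basic action theory, with initial theory $\mathcal{D}_{S_0}$ and unique name axioms $\mathcal{D}_{una}$, such that $\mathcal{D}_{S_0}$ and $\mathcal{D}_{una}$ are theories in $\mathcal{L}$. Let $\alpha$ be a ground action term, $S_\alpha = do(\alpha,S_0)$, and let $\mathcal{D}_{S_\alpha}$ be a progression of $\mathcal{D}_{S_0}$ with respect to $\alpha$. Let $\sigma\subseteq \mathrm{sig}(\mathcal{D}_{S_0})$ be a fluent-free signature and put $\Delta=\mathrm{sig}(\mathcal{D}_{una})\cup\sigma$. Suppose that: (1) $\mathcal{D}_{S_0}$ is $\sigma$-decomposable with some components $\{D_i\}_{i\in I}$, $I\subseteq\omega$, such that the theories in $\{\mathcal{D}_{una}\cup D_i\}_{i\in I}$ are pairwise $\Delta$-inseparable; (2) $\mathcal{D}_{S_\alpha}(S_0/S_\alpha)$ is equivalent to the union of theories $\{D'_j\}_{j\in J}$, $J\subseteq\omega$, such that for every $j\in J$ there is some $i\in I$ with $\mathrm{Cons}(\mathcal{D}_{una}\cup D'_j,\Delta)\supseteq \mathrm{Cons}(\mathcal{D}_{una}\cup D_i,\Delta)$. Then the theories in $\{\mathcal{D}_{una}\cup D'_j\}_{j\in J}$ are pairwise $\Delta$-inseparable.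
   Context: **Logic.** $\mathcal{L}$ is a (possibly many-sorted) logic that is a fragment (a set of sentences) of second-order logic with standard Tarskian semantics. A signature is a set of non-logical symbols (equality is logical). A theory is a set of sentences of $\mathcal{L}$; $\mathrm{sig}(\cdot)$ is the set of non-logical symbols occurring in a formula, term or theory. $\mathrm{Cons}(\mathcal{T},\Delta)=\{\varphi\in\mathcal{L}\mid \mathcal{T}\models\varphi,\ \mathrm{sig}(\varphi)\subseteq\Delta\}$. Theories $\mathcal{T}_1,\mathcal{T}_2$ are $\Delta$-inseparable if $\mathrm{Cons}(\mathcal{T}_1,\Delta)=\mathrm{Cons}(\mathcal{T}_2,\Delta)$. **Decomposability.** For $\Delta\subseteq\mathrm{sig}(\mathcal{T})$, $\mathcal{T}$ is $\Delta$-decomposable if there are theories $\mathcal{T}_1,\mathcal{T}_2$ in $\mathcal{L}$ (the components) with $\mathrm{sig}(\mathcal{T}_1)\cap\mathrm{sig}(\mathcal{T}_2)=\Delta$, $\mathrm{sig}(\mathcal{T}_1)\ne\Delta\ne\mathrm{sig}(\mathcal{T}_2)$, $\mathrm{sig}(\mathcal{T}_1)\cup\mathrm{sig}(\mathcal{T}_2)=\mathrm{sig}(\mathcal{T})$, and $\mathcal{T}\equiv\mathcal{T}_1\cup\mathcal{T}_2$. This extends to families of components: pairwise signature intersections equal $\Delta$, each component's signature differs from $\Delta$, the union of the signatures is $\mathrm{sig}(\mathcal{T})$, and $\mathcal{T}$ is equivalent to the union of the components. **PIP.** $\mathcal{L}$ has the parallel interpolation property if for any theories $\mathcal{T}_1,\mathcal{T}_2$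 in $\mathcal{L}$ with $\mathrm{sig}(\mathcal{T}_1)\cap\mathrm{sig}(\mathcal{T}_2)=\Delta$ and any $\varphi\in\mathcal{L}$ with $\mathcal{T}_1\cup\mathcal{T}_2\models\varphi$, there are sets of formulas $\mathcal{T}_1',\mathcal{T}_2'$ in $\mathcal{L}$ with $\mathcal{T}_i\models\mathcal{T}_i'$ ($i=1,2$), $\mathcal{T}_1'\cup\mathcal{T}_2'\models\varphi$, and $\mathrm{sig}(\mathcal{T}_i')\setminus\Delta\subseteq(\mathrm{sig}(\mathcal{T}_i)\cap\mathrm{sig}(\varphi))\setminus\Delta$. **Situation calculus language.** $\mathcal{L}_{sc}$ has first-order syntax over three sorts action, situation, object, with alphabet $\{do,\preceq,S_0,Poss\}\cup\mathcal{A}\cup\mathcal{F}\cup\mathcal{O}\cup\mathcal{P}$: $do$ is a binary function (action, situation) $\to$ situation; $\preceq$ a binary relation on situations; $S_0$ a constant of sort situation; $Poss$ a binary predicate (action, situation); $\mathcal{A}$ action functions with object arguments; $\mathcal{F}$ fluents, i.e. predicates with object arguments and one last argument of sort situation; $\mathcal{O}$ object constants; $\mathcal{P}$ static predicates and functions (only object arguments). Symbols in $\mathcal{A}\cup\mathcal{O}\cup\mathcal{P}$ are called situation-independent. A signature is fluent-free if it contains no fluent. A formula is uniform in a situation term $S$ if it has no quantifiers over situation variables, no equalities between situation terms, no occurrence of $Poss$ or $\preceq$, and the situation argument of every fluent occurring in it is $S$; a set of formulas is uniform in $S$ if all its members are. For $\mathcal{T}$ uniform in $S$, $\mathcal{T}(S'/S)$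 is obtained by replacing every occurrence of $S$ with $S'$; so $\mathcal{D}_{S_\alpha}(S_0/S_\alpha)$ is $\mathcal{D}_{S_\alpha}$ with $S_\alpha$ replaced by $S_0$. **Basic action theory.** $\mathcal{D}=\Sigma\cup\mathcal{D}_{una}\cup\mathcal{D}_{S_0}\cup\mathcal{D}_{ap}\cup\mathcal{D}_{ss}$ over a signature contained in the alphabet above, where: - $\Sigma$ (foundational axioms): $\forall a_1,a_2,s_1,s_2\,[do(a_1,s_1)=do(a_2,s_2)\to a_1=a_2\wedge s_1=s_2]$; $\forall s\,\neg(s\preceq S_0\wedge s\ne S_0)$; $\forall s_1,s_2\,[s_1\preceq s_2\leftrightarrow\exists a\,(do(a,s_1)\preceq s_2)\vee s_1=s_2]$; second-order induction $\forall P\,[P(S_0)\wedge\forall a,s\,(P(s)\to P(do(a,s)))\to\forall s\,P(s)]$. - $\mathcal{D}_{una}$ consists exactly of: $b\ne b'$ for distinct object constants; $\forall\bar x,\bar y\ A(\bar x)\ne A'(\bar y)$ for distinct action functions; $\forall\bar x,\bar y\ A(\bar x)=A(\bar y)\to\bar x=\bar y$ for each action function. - $\mathcal{D}_{S_0}$ (initial theory): a set of sentences uniform in $S_0$ (translatable into first-order sentences uniform in $S_0$). - $\mathcal{D}_{ap}$: for each action function $A$ one axiom $\forall\bar x,s\,(Poss(A(\bar x),s)\leftrightarrow\Pi_A(\bar x,s))$ with $\Pi_A$ uniform in $s$ and free variables among $\bar x,s$. - $\mathcal{D}_{ss}$: for each fluent $F$ one successor state axiom $\forall\bar x,a,s\,(F(\bar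 x,do(a,s))\leftrightarrow\gamma_F^+(\bar x,a,s)\vee F(\bar x,s)\wedge\neg\gamma_F^-(\bar x,a,s))$, where $\gamma_F^{+}$ and $\gamma_F^{-}$ are (possibly empty, i.e. false) disjunctions of formulas $[\exists\bar y](a=A(\bar t)\wedge\phi(\bar x,\bar y,s))$ with $A$ an action function (said to be in active position), $\bar t$ a vector of object terms with variables among $\bar x,\bar y$, and $\phi$ uniform in $s$ with variables among $\bar x,\bar y,s$. No action function occurs in active position in both $\gamma_F^+$ and $\gamma_F^-$. **Progression.** For structures $\mathcal{M},\mathcal{M}'$ write $\mathcal{M}\sim_{S_\alpha}\mathcal{M}'$ if they have the same domains for sorts action and object, interpret all situation-independent symbols identically, and agree on all fluents at $S_\alpha$ (for every fluent $F$ and assignment $\theta$: $\mathcal{M},\theta\models F(\bar x,S_\alpha)$ iff $\mathcal{M}',\theta\models F(\bar x,S_\alpha)$). A set $\mathcal{D}_{S_\alpha}$ of formulas in a fragment of second-order logic is a progression of $\mathcal{D}_{S_0}$ with respect to $\alpha$ if it is uniform in $S_\alpha$ and for every model $\mathcal{M}$ of $\Sigma\cup\mathcal{D}_{ss}\cup\mathcal{D}_{ap}\cup\mathcal{D}_{una}$: $\mathcal{M}\models\mathcal{D}_{S_\alpha}$ iff there is a model $\mathcal{M}'$ of $\mathcal{D}$ with $\mathcal{M}\sim_{S_\alpha}\mathcal{M}'$.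
   Formalization: For infinite I, parallel interpolation is assumed for I-indexed families (the claim fails otherwise for non-compact logics); uniform formulas also bar second-order quantifiers over situations; consequence ranges over structures inside an arbitrary infinite universe. *)

theory Defs
  imports Main "HOL-Library.Infinite_Typeclass"
begin

section \<open>Alphabet\<close>

datatype sort = Act | Sit | Obj

text \<open>A symbol of variable arity is a name together with its arity, so that ranks are intrinsic;
  the alphabet of a particular situation calculus language is a subset of \<open>'n symbol\<close>.\<close>

datatype 'n fsym = Do | S0 | Action 'n nat | Const 'n | SFun 'n nat
datatype 'n psym = Preceq | Poss | Fluent 'n nat | SPred 'n nat
datatype 'n symbol = FSym "'n fsym" | PSym "'n psym"

fun fargs :: "'n fsym \<Rightarrow> sort list" where
  "fargs Do = [Act, Sit]"
| "fargs S0 = []"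
| "fargs (Action A n) = replicate n Obj"
| "fargs (Const b) = []"
| "fargs (SFun g n) = replicate n Obj"

fun fres :: "'n fsym \<Rightarrow> sort" where
  "fres Do = Sit"
| "fres S0 = Sit"
| "fres (Action A n) = Act"
| "fres (Const b) = Obj"
| "fres (SFun g n) = Obj"

fun pargs :: "'n psym \<Rightarrow> sort list" where
  "pargs Preceq = [Sit, Sit]"
| "pargs Poss = [Act, Sit]"
| "pargs (Fluent F n) = replicate n Obj @ [Sit]"
| "pargs (SPred p n) = replicate n Obj"

definition fluent_free :: "'n symbol set \<Rightarrow> bool" where
  "fluent_free \<sigma> \<longleftrightarrow> (\<forall>F n. PSym (Fluent F n) \<notin> \<sigma>)"

fun sit_indep_fun :: "'n fsym \<Rightarrow> bool" where
  "sit_indep_fun Do = False"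
| "sit_indep_fun S0 = False"
| "sit_indep_fun (Action A n) = True"
| "sit_indep_fun (Const b) = True"
| "sit_indep_fun (SFun g n) = True"

fun sit_indep_pred :: "'n psym \<Rightarrow> bool" where
  "sit_indep_pred Preceq = False"
| "sit_indep_pred Poss = False"
| "sit_indep_pred (Fluent F n) = False"
| "sit_indep_pred (SPred p n) = True"


section \<open>Three-sorted second-order logic: syntax\<close>

text \<open>Variables carry their sort (type) and an index: individual variables, relation variables
  with a list of argument sorts, function variables with argument sorts and a result sort.\<close>

type_synonym ivar = "sort \<times> nat"
type_synonym rvar = "sort list \<times> nat"
type_synonym fvar = "sort list \<times> sort \<times> nat"
datatype variable = IV ivar | RV rvar | FV fvar

datatype 'n tm =
  Var ivar
| Fun "'n fsym" "'n tm list"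
| FunVar fvar "'n tm list"

datatype 'n fm =
  Fls
| Eq "'n tm" "'n tm"
| Rel "'n psym" "'n tm list"
| RelVar rvar "'n tm list"
| Imp "'n fm" "'n fm"
| Forall ivar "'n fm"
| ForallR rvar "'n fm"
| ForallF fvar "'n fm"

abbreviation Neg :: "'n fm \<Rightarrow> 'n fm" where "Neg \<phi> \<equiv> Imp \<phi> Fls"
abbreviation Disj :: "'n fm \<Rightarrow> 'n fm \<Rightarrow> 'n fm" where "Disj \<phi> \<psi> \<equiv> Imp (Neg \<phi>) \<psi>"
abbreviation Conj :: "'n fm \<Rightarrow> 'n fm \<Rightarrow> 'n fm" where "Conj \<phi> \<psi> \<equiv> Neg (Imp \<phi> (Neg \<psi>))"
abbreviation Iff :: "'n fm \<Rightarrow> 'n fm \<Rightarrow> 'n fm" where "Iff \<phi> \<psi> \<equiv> Conj (Imp \<phi> \<psi>) (Imp \<psi> \<phi>)"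
abbreviation Exists :: "ivar \<Rightarrow> 'n fm \<Rightarrow> 'n fm" where "Exists v \<phi> \<equiv> Neg (Forall v (Neg \<phi>))"

definition Alls :: "ivar list \<Rightarrow> 'n fm \<Rightarrow> 'n fm" where "Alls vs \<phi> = foldr Forall vs \<phi>"
definition Exs :: "ivar list \<Rightarrow> 'n fm \<Rightarrow> 'n fm" where "Exs vs \<phi> = foldr (\<lambda>v \<psi>. Exists v \<psi>) vs \<phi>"
definition Conjs :: "'n fm list \<Rightarrow> 'n fm" where "Conjs \<phi>s = foldr (\<lambda>\<phi> \<psi>. Conj \<phi> \<psi>) \<phi>s (Neg Fls)"
definition Disjs :: "'n fm list \<Rightarrow> 'n fm" where "Disjs \<phi>s = foldr (\<lambda>\<phi> \<psi>. Disj \<phi> \<psi>) \<phi>s Fls"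

fun tm_sort :: "'n tm \<Rightarrow> sort" where
  "tm_sort (Var (s, x)) = s"
| "tm_sort (Fun f ts) = fres f"
| "tm_sort (FunVar (ss, r, x) ts) = r"

fun wf_tm :: "'n tm \<Rightarrow> bool" where
  "wf_tm (Var v) = True"
| "wf_tm (Fun f ts) = ((\<forall>t \<in> set ts. wf_tm t) \<and> map tm_sort ts = fargs f)"
| "wf_tm (FunVar g ts) = ((\<forall>t \<in> set ts. wf_tm t) \<and> map tm_sort ts = fst g)"

primrec wf_fm :: "'n fm \<Rightarrow> bool" where
  "wf_fm Fls = True"
| "wf_fm (Eq t u) = (wf_tm t \<and> wf_tm u \<and> tm_sort t = tm_sort u)"
| "wf_fm (Rel p ts) = ((\<forall>t \<in> set ts. wf_tm t) \<and> map tm_sort ts = pargs p)"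
| "wf_fm (RelVar R ts) = ((\<forall>t \<in> set ts. wf_tm t) \<and> map tm_sort ts = fst R)"
| "wf_fm (Imp \<phi> \<psi>) = (wf_fm \<phi> \<and> wf_fm \<psi>)"
| "wf_fm (Forall v \<phi>) = wf_fm \<phi>"
| "wf_fm (ForallR R \<phi>) = wf_fm \<phi>"
| "wf_fm (ForallF g \<phi>) = wf_fm \<phi>"

fun fv_tm :: "'n tm \<Rightarrow> variable set" where
  "fv_tm (Var v) = {IV v}"
| "fv_tm (Fun f ts) = (\<Union>t \<in> set ts. fv_tm t)"
| "fv_tm (FunVar g ts) = insert (FV g) (\<Union>t \<in> set ts. fv_tm t)"

primrec fv :: "'n fm \<Rightarrow> variable set" where
  "fv Fls = {}"
| "fv (Eq t u) = fv_tm t \<union> fv_tm u"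
| "fv (Rel p ts) = (\<Union>t \<in> set ts. fv_tm t)"
| "fv (RelVar R ts) = insert (RV R) (\<Union>t \<in> set ts. fv_tm t)"
| "fv (Imp \<phi> \<psi>) = fv \<phi> \<union> fv \<psi>"
| "fv (Forall v \<phi>) = fv \<phi> - {IV v}"
| "fv (ForallR R \<phi>) = fv \<phi> - {RV R}"
| "fv (ForallF g \<phi>) = fv \<phi> - {FV g}"

definition sentence :: "'n fm \<Rightarrow> bool" where
  "sentence \<phi> \<longleftrightarrow> wf_fm \<phi> \<and> fv \<phi> = {}"

fun sig_tm :: "'n tm \<Rightarrow> 'n symbol set" where
  "sig_tm (Var v) = {}"
| "sig_tm (Fun f ts) = insert (FSym f) (\<Union>t \<in> set ts. sig_tm t)"
| "sig_tm (FunVar g ts) = (\<Union>t \<in> set ts. sig_tm t)"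

primrec sig_fm :: "'n fm \<Rightarrow> 'n symbol set" where
  "sig_fm Fls = {}"
| "sig_fm (Eq t u) = sig_tm t \<union> sig_tm u"
| "sig_fm (Rel p ts) = insert (PSym p) (\<Union>t \<in> set ts. sig_tm t)"
| "sig_fm (RelVar R ts) = (\<Union>t \<in> set ts. sig_tm t)"
| "sig_fm (Imp \<phi> \<psi>) = sig_fm \<phi> \<union> sig_fm \<psi>"
| "sig_fm (Forall v \<phi>) = sig_fm \<phi>"
| "sig_fm (ForallR R \<phi>) = sig_fm \<phi>"
| "sig_fm (ForallF g \<phi>) = sig_fm \<phi>"

definition sig :: "'n fm set \<Rightarrow> 'n symbol set" where
  "sig T = (\<Union>\<phi> \<in> T. sig_fm \<phi>)"

fun fo_tm :: "'n tm \<Rightarrow> bool" where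
  "fo_tm (Var v) = True"
| "fo_tm (Fun f ts) = (\<forall>t \<in> set ts. fo_tm t)"
| "fo_tm (FunVar g ts) = False"

primrec first_order :: "'n fm \<Rightarrow> bool" where
  "first_order Fls = True"
| "first_order (Eq t u) = (fo_tm t \<and> fo_tm u)"
| "first_order (Rel p ts) = (\<forall>t \<in> set ts. fo_tm t)"
| "first_order (RelVar R ts) = False"
| "first_order (Imp \<phi> \<psi>) = (first_order \<phi> \<and> first_order \<psi>)"
| "first_order (Forall v \<phi>) = first_order \<phi>"
| "first_order (ForallR R \<phi>) = False"
| "first_order (ForallF g \<phi>) = False"


section \<open>Semantics\<close>

record ('n, 'u) struct =
  univ :: "sort \<Rightarrow> 'u set"
  fint :: "'n fsym \<Rightarrow> 'u list \<Rightarrow> 'u"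
  rint :: "'n psym \<Rightarrow> 'u list \<Rightarrow> bool"

record 'u assignment =
  ival :: "ivar \<Rightarrow> 'u"
  rval :: "rvar \<Rightarrow> 'u list \<Rightarrow> bool"
  fval :: "fvar \<Rightarrow> 'u list \<Rightarrow> 'u"

definition tuples :: "('n, 'u) struct \<Rightarrow> sort list \<Rightarrow> 'u list set" where
  "tuples M ss = {ds. list_all2 (\<lambda>d s. d \<in> univ M s) ds ss}"

definition is_struct :: "('n, 'u) struct \<Rightarrow> bool" where
  "is_struct M \<longleftrightarrow> (\<forall>s. univ M s \<noteq> {}) \<and>
     (\<forall>f. \<forall>ds \<in> tuples M (fargs f). fint M f ds \<in> univ M (fres f))"

text \<open>Function and relation values outside the relevant tuples are junk; no well-formed formula
  can observe them.\<close>

definition is_assignment :: "('n, 'u) struct \<Rightarrow> 'u assignment \<Rightarrow> bool" where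
  "is_assignment M e \<longleftrightarrow> (\<forall>s x. ival e (s, x) \<in> univ M s) \<and>
     (\<forall>ss r x. \<forall>ds \<in> tuples M ss. fval e (ss, r, x) ds \<in> univ M r)"

fun tm_val :: "('n, 'u) struct \<Rightarrow> 'u assignment \<Rightarrow> 'n tm \<Rightarrow> 'u" where
  "tm_val M e (Var v) = ival e v"
| "tm_val M e (Fun f ts) = fint M f (map (tm_val M e) ts)"
| "tm_val M e (FunVar g ts) = fval e g (map (tm_val M e) ts)"

primrec sat :: "('n, 'u) struct \<Rightarrow> 'n fm \<Rightarrow> 'u assignment \<Rightarrow> bool" where
  "sat M Fls e = False"
| "sat M (Eq t u) e = (tm_val M e t = tm_val M e u)"
| "sat M (Rel p ts) e = rint M p (map (tm_val M e) ts)"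
| "sat M (RelVar R ts) e = rval e R (map (tm_val M e) ts)"
| "sat M (Imp \<phi> \<psi>) e = (sat M \<phi> e \<longrightarrow> sat M \<psi> e)"
| "sat M (Forall v \<phi>) e = (\<forall>d \<in> univ M (fst v). sat M \<phi> (e\<lparr>ival := (ival e)(v := d)\<rparr>))"
| "sat M (ForallR R \<phi>) e = (\<forall>Q. sat M \<phi> (e\<lparr>rval := (rval e)(R := Q)\<rparr>))"
| "sat M (ForallF g \<phi>) e =
     (\<forall>h. (\<forall>ds \<in> tuples M (fst g). h ds \<in> univ M (fst (snd g))) \<longrightarrow>
          sat M \<phi> (e\<lparr>fval := (fval e)(g := h)\<rparr>))"

definition models :: "('n, 'u) struct \<Rightarrow> 'n fm set \<Rightarrow> bool" where
  "models M T \<longleftrightarrow> (\<forall>\<phi> \<in> T. \<forall>e. is_assignment M e \<longrightarrow> sat M \<phi> e)"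

text \<open>HOL cannot quantify over all types inside a definition, so the structures that
  consequence refers to are those whose domains are subsets of a type \<open>'u\<close>, which is passed as an
  \<open>itself\<close> argument and is meant to remain arbitrary. Second-order consequence depends
  on \<open>'u\<close>, but over a type of large enough cardinality it is the usual relation.\<close>

definition entails :: "'u itself \<Rightarrow> 'n fm set \<Rightarrow> 'n fm \<Rightarrow> bool" where
  "entails U T \<phi> \<longleftrightarrow>
     (\<forall>M :: ('n, 'u) struct. is_struct M \<longrightarrow> models M T \<longrightarrow> models M {\<phi>})"

definition entails_set :: "'u itself \<Rightarrow> 'n fm set \<Rightarrow> 'n fm set \<Rightarrow> bool" where
  "entails_set U T T' \<longleftrightarrow> (\<forall>\<phi> \<in> T'. entails U T \<phi>)"

definition equivalent :: "'u itself \<Rightarrow> 'n fm set \<Rightarrow> 'n fm set \<Rightarrow> bool" where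
  "equivalent U T T' \<longleftrightarrow>
     (\<forall>M :: ('n, 'u) struct. is_struct M \<longrightarrow> (models M T \<longleftrightarrow> models M T'))"


section \<open>Logics, inseparability, decomposability, parallel interpolation\<close>

definition is_logic :: "'n fm set \<Rightarrow> bool" where
  "is_logic L \<longleftrightarrow> (\<forall>\<phi> \<in> L. sentence \<phi>)"

definition Consq :: "'u itself \<Rightarrow> 'n fm set \<Rightarrow> 'n fm set \<Rightarrow> 'n symbol set \<Rightarrow> 'n fm set" where
  "Consq U L T \<Delta> = {\<phi> \<in> L. entails U T \<phi> \<and> sig_fm \<phi> \<subseteq> \<Delta>}"

definition inseparable ::
  "'u itself \<Rightarrow> 'n fm set \<Rightarrow> 'n symbol set \<Rightarrow> 'n fm set \<Rightarrow> 'n fm set \<Rightarrow> bool" where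
  "inseparable U L \<Delta> T\<^sub>1 T\<^sub>2 \<longleftrightarrow> Consq U L T\<^sub>1 \<Delta> = Consq U L T\<^sub>2 \<Delta>"

definition decomposable_with ::
  "'u itself \<Rightarrow> 'n fm set \<Rightarrow> 'n symbol set \<Rightarrow> 'n fm set \<Rightarrow> nat set \<Rightarrow> (nat \<Rightarrow> 'n fm set) \<Rightarrow> bool"
where
  "decomposable_with U L \<Delta> T I D \<longleftrightarrow>
     \<Delta> \<subseteq> sig T \<and>
     (\<forall>i \<in> I. D i \<subseteq> L) \<and>
     (\<forall>i \<in> I. \<forall>j \<in> I. i \<noteq> j \<longrightarrow> sig (D i) \<inter> sig (D j) = \<Delta>) \<and>
     (\<forall>i \<in> I. sig (D i) \<noteq> \<Delta>) \<and>
     (\<Union>i \<in> I. sig (D i)) = sig T \<and>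
     equivalent U T (\<Union>i \<in> I. D i)"

definition has_PIP :: "'u itself \<Rightarrow> 'n fm set \<Rightarrow> bool" where
  "has_PIP U L \<longleftrightarrow>
     (\<forall>T\<^sub>1 T\<^sub>2 \<Delta> \<phi>. T\<^sub>1 \<subseteq> L \<longrightarrow> T\<^sub>2 \<subseteq> L \<longrightarrow> sig T\<^sub>1 \<inter> sig T\<^sub>2 = \<Delta> \<longrightarrow> \<phi> \<in> L \<longrightarrow>
        entails U (T\<^sub>1 \<union> T\<^sub>2) \<phi> \<longrightarrow>
        (\<exists>T\<^sub>1' T\<^sub>2'. T\<^sub>1' \<subseteq> L \<and> T\<^sub>2' \<subseteq> L \<and>
           entails_set U T\<^sub>1 T\<^sub>1' \<and> entails_set U T\<^sub>2 T\<^sub>2' \<and>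
           entails U (T\<^sub>1' \<union> T\<^sub>2') \<phi> \<and>
           sig T\<^sub>1' - \<Delta> \<subseteq> (sig T\<^sub>1 \<inter> sig_fm \<phi>) - \<Delta> \<and>
           sig T\<^sub>2' - \<Delta> \<subseteq> (sig T\<^sub>2 \<inter> sig_fm \<phi>) - \<Delta>))"

text \<open>Parallel interpolation for families of theories indexed by \<open>I\<close>. For finite \<open>I\<close> with at
  least two elements it follows from the property for pairs by iteration, for infinite \<open>I\<close> it
  does not, since consequence in \<open>L\<close> need not be compact.\<close>

definition has_PIP_family :: "'u itself \<Rightarrow> 'n fm set \<Rightarrow> nat set \<Rightarrow> bool" where
  "has_PIP_family U L I \<longleftrightarrow>
     (\<forall>T \<Delta> \<phi>. (\<forall>i \<in> I. T i \<subseteq> L) \<longrightarrow>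
        (\<forall>i \<in> I. \<forall>j \<in> I. i \<noteq> j \<longrightarrow> sig (T i) \<inter> sig (T j) = \<Delta>) \<longrightarrow> \<phi> \<in> L \<longrightarrow>
        entails U (\<Union>i \<in> I. T i) \<phi> \<longrightarrow>
        (\<exists>T'. (\<forall>i \<in> I. T' i \<subseteq> L) \<and>
           (\<forall>i \<in> I. entails_set U (T i) (T' i)) \<and>
           entails U (\<Union>i \<in> I. T' i) \<phi> \<and>
           (\<forall>i \<in> I. sig (T' i) - \<Delta> \<subseteq> (sig (T i) \<inter> sig_fm \<phi>) - \<Delta>)))"


section \<open>Uniform formulas\<close>

text \<open>Second-order variables with the sort situation among their argument or result sorts
  count as situation variables: quantifying over them would express
  equality and quantification of situations (\<open>\<exists>P. P(s) \<and> \<not>P(s')\<close> says that \<open>s\<close> and \<open>s'\<close> differ).\<close>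

primrec uniform :: "'n tm \<Rightarrow> 'n fm \<Rightarrow> bool" where
  "uniform S Fls = True"
| "uniform S (Eq t u) = (tm_sort t \<noteq> Sit \<and> tm_sort u \<noteq> Sit)"
| "uniform S (Rel p ts) =
     (p \<noteq> Poss \<and> p \<noteq> Preceq \<and> (\<forall>F n. p = Fluent F n \<longrightarrow> last ts = S))"
| "uniform S (RelVar R ts) = True"
| "uniform S (Imp \<phi> \<psi>) = (uniform S \<phi> \<and> uniform S \<psi>)"
| "uniform S (Forall v \<phi>) = (fst v \<noteq> Sit \<and> uniform S \<phi>)"
| "uniform S (ForallR R \<phi>) = (Sit \<notin> set (fst R) \<and> uniform S \<phi>)"
| "uniform S (ForallF g \<phi>) = (Sit \<notin> set (fst g) \<and> fst (snd g) \<noteq> Sit \<and> uniform S \<phi>)"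

fun repl_tm :: "'n tm \<Rightarrow> 'n tm \<Rightarrow> 'n tm \<Rightarrow> 'n tm" where
  "repl_tm S S' (Var v) = (if Var v = S then S' else Var v)"
| "repl_tm S S' (Fun f ts) =
     (if Fun f ts = S then S' else Fun f (map (repl_tm S S') ts))"
| "repl_tm S S' (FunVar g ts) =
     (if FunVar g ts = S then S' else FunVar g (map (repl_tm S S') ts))"

text \<open>Only used for ground \<open>S\<close> and \<open>S'\<close>, so that no variable capture can arise.\<close>

primrec repl_fm :: "'n tm \<Rightarrow> 'n tm \<Rightarrow> 'n fm \<Rightarrow> 'n fm" where
  "repl_fm S S' Fls = Fls"
| "repl_fm S S' (Eq t u) = Eq (repl_tm S S' t) (repl_tm S S' u)"
| "repl_fm S S' (Rel p ts) = Rel p (map (repl_tm S S') ts)"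
| "repl_fm S S' (RelVar R ts) = RelVar R (map (repl_tm S S') ts)"
| "repl_fm S S' (Imp \<phi> \<psi>) = Imp (repl_fm S S' \<phi>) (repl_fm S S' \<psi>)"
| "repl_fm S S' (Forall v \<phi>) = Forall v (repl_fm S S' \<phi>)"
| "repl_fm S S' (ForallR R \<phi>) = ForallR R (repl_fm S S' \<phi>)"
| "repl_fm S S' (ForallF g \<phi>) = ForallF g (repl_fm S S' \<phi>)"


section \<open>Basic action theories\<close>

definition s0 :: "'n tm" where "s0 = Fun S0 []"
definition do_tm :: "'n tm \<Rightarrow> 'n tm \<Rightarrow> 'n tm" where "do_tm a s = Fun Do [a, s]"

definition avar :: "nat \<Rightarrow> 'n tm" where "avar i = Var (Act, i)"
definition svar :: "nat \<Rightarrow> 'n tm" where "svar i = Var (Sit, i)"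
definition ovars :: "nat list \<Rightarrow> 'n tm list" where "ovars is = map (\<lambda>i. Var (Obj, i)) is"

definition preceq :: "'n tm \<Rightarrow> 'n tm \<Rightarrow> 'n fm" where "preceq s s' = Rel Preceq [s, s']"

definition foundational :: "'n fm set" where
  "foundational =
     {Alls [(Act, 1), (Act, 2), (Sit, 1), (Sit, 2)]
        (Imp (Eq (do_tm (avar 1) (svar 1)) (do_tm (avar 2) (svar 2)))
             (Conj (Eq (avar 1) (avar 2)) (Eq (svar 1) (svar 2)))),
      Forall (Sit, 0) (Neg (Conj (preceq (svar 0) s0) (Neg (Eq (svar 0) s0)))),
      Alls [(Sit, 1), (Sit, 2)]
        (Iff (preceq (svar 1) (svar 2))
             (Disj (Exists (Act, 0) (preceq (do_tm (avar 0) (svar 1)) (svar 2)))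
                   (Eq (svar 1) (svar 2)))),
      ForallR ([Sit], 0)
        (Imp (Conj (RelVar ([Sit], 0) [s0])
                   (Alls [(Act, 0), (Sit, 0)]
                      (Imp (RelVar ([Sit], 0) [svar 0])
                           (RelVar ([Sit], 0) [do_tm (avar 0) (svar 0)]))))
             (Forall (Sit, 0) (RelVar ([Sit], 0) [svar 0])))}"

text \<open>\<open>Sg\<close> is the signature over which the basic action theory is formulated. Bound
  variables have canonical names: object arguments are \<open>x\<^sub>0, x\<^sub>1, \<dots>\<close>, and the action and the
  situation variable of an axiom have index 0.\<close>

definition una_axioms :: "'n symbol set \<Rightarrow> 'n fm set" where
  "una_axioms Sg =
     {Neg (Eq (Fun (Const b) []) (Fun (Const b') [])) | b b'.
        FSym (Const b) \<in> Sg \<and> FSym (Const b') \<in> Sg \<and> b \<noteq> b'} \<union>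
     {Alls (map (Pair Obj) [0..<m + n])
        (Neg (Eq (Fun (Action A m) (ovars [0..<m])) (Fun (Action B n) (ovars [m..<m + n]))))
      | A m B n. FSym (Action A m) \<in> Sg \<and> FSym (Action B n) \<in> Sg \<and> (A, m) \<noteq> (B, n)} \<union>
     {Alls (map (Pair Obj) [0..<n + n])
        (Imp (Eq (Fun (Action A n) (ovars [0..<n])) (Fun (Action A n) (ovars [n..<n + n])))
             (Conjs (map2 Eq (ovars [0..<n]) (ovars [n..<n + n]))))
      | A n. FSym (Action A n) \<in> Sg}"

definition initial_theory :: "'u itself \<Rightarrow> 'n fm set \<Rightarrow> bool" where
  "initial_theory U T \<longleftrightarrow>
     (\<forall>\<phi> \<in> T. sentence \<phi> \<and> uniform s0 \<phi> \<and>
        (\<exists>\<psi>. sentence \<psi> \<and> first_order \<psi> \<and> uniform s0 \<psi> \<and> equivalent U {\<phi>} {\<psi>}))"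

definition ap_condition :: "nat \<Rightarrow> 'n fm \<Rightarrow> bool" where
  "ap_condition n \<Pi> \<longleftrightarrow> wf_fm \<Pi> \<and> first_order \<Pi> \<and> uniform (svar 0) \<Pi> \<and>
     fv \<Pi> \<subseteq> insert (IV (Sit, 0)) ((\<lambda>i. IV (Obj, i)) ` {..<n})"

definition ap_axiom :: "'n \<Rightarrow> nat \<Rightarrow> 'n fm \<Rightarrow> 'n fm" where
  "ap_axiom A n \<Pi> =
     Alls (map (Pair Obj) [0..<n] @ [(Sit, 0)])
       (Iff (Rel Poss [Fun (Action A n) (ovars [0..<n]), svar 0]) \<Pi>)"

definition precondition_axioms :: "'n symbol set \<Rightarrow> 'n fm set \<Rightarrow> bool" where
  "precondition_axioms Sg T \<longleftrightarrow>
     (\<exists>\<Pi>. (\<forall>A n. FSym (Action A n) \<in> Sg \<longrightarrow> ap_condition n (\<Pi> A n)) \<and>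
          T = {ap_axiom A n (\<Pi> A n) | A n. FSym (Action A n) \<in> Sg})"

text \<open>\<open>Effect ys A ts \<phi>\<close> stands for the disjunct \<open>\<exists>ys. a = A(ts) \<and> \<phi>\<close> of \<open>\<gamma>\<^sub>F\<^sup>+\<close> or \<open>\<gamma>\<^sub>F\<^sup>-\<close>; the
  arity of \<open>A\<close> is the length of \<open>ts\<close>.\<close>

datatype 'n effect = Effect "nat list" 'n "'n tm list" "'n fm"

fun effect_fm :: "'n effect \<Rightarrow> 'n fm" where
  "effect_fm (Effect ys A ts \<phi>) =
     Exs (map (Pair Obj) ys) (Conj (Eq (avar 0) (Fun (Action A (length ts)) ts)) \<phi>)"

fun active :: "'n effect \<Rightarrow> 'n fsym" where
  "active (Effect ys A ts \<phi>) = Action A (length ts)"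

fun wf_effect :: "nat \<Rightarrow> 'n effect \<Rightarrow> bool" where
  "wf_effect n (Effect ys A ts \<phi>) \<longleftrightarrow>
     (\<forall>t \<in> set ts. wf_tm t \<and> tm_sort t = Obj \<and> fo_tm t \<and>
        fv_tm t \<subseteq> (\<lambda>i. IV (Obj, i)) ` ({..<n} \<union> set ys)) \<and>
     wf_fm \<phi> \<and> first_order \<phi> \<and> uniform (svar 0) \<phi> \<and>
     fv \<phi> \<subseteq> insert (IV (Sit, 0)) ((\<lambda>i. IV (Obj, i)) ` ({..<n} \<union> set ys))"

definition ss_axiom :: "'n \<Rightarrow> nat \<Rightarrow> 'n effect list \<Rightarrow> 'n effect list \<Rightarrow> 'n fm" where
  "ss_axiom F n pos neg =
     Alls (map (Pair Obj) [0..<n] @ [(Act, 0), (Sit, 0)])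
       (Iff (Rel (Fluent F n) (ovars [0..<n] @ [do_tm (avar 0) (svar 0)]))
            (Disj (Disjs (map effect_fm pos))
                  (Conj (Rel (Fluent F n) (ovars [0..<n] @ [svar 0]))
                        (Neg (Disjs (map effect_fm neg))))))"

definition successor_state_axioms :: "'n symbol set \<Rightarrow> 'n fm set \<Rightarrow> bool" where
  "successor_state_axioms Sg T \<longleftrightarrow>
     (\<exists>pos neg.
        (\<forall>F n. PSym (Fluent F n) \<in> Sg \<longrightarrow>
           (\<forall>E \<in> set (pos F n) \<union> set (neg F n). wf_effect n E) \<and>
           active ` set (pos F n) \<inter> active ` set (neg F n) = {}) \<and>
        T = {ss_axiom F n (pos F n) (neg F n) | F n. PSym (Fluent F n) \<in> Sg})"

definition basic_action_theory ::
  "'u itself \<Rightarrow> 'n symbol set \<Rightarrow> 'n fm set \<Rightarrow> 'n fm set \<Rightarrow> 'n fm set \<Rightarrow> 'n fm set \<Rightarrow> bool"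
where
  "basic_action_theory U Sg Duna DS0 Dap Dss \<longleftrightarrow>
     Duna = una_axioms Sg \<and>
     initial_theory U DS0 \<and>
     precondition_axioms Sg Dap \<and>
     successor_state_axioms Sg Dss \<and>
     sig (foundational \<union> Duna \<union> DS0 \<union> Dap \<union> Dss) \<subseteq> Sg"


section \<open>Progression\<close>

definition ground_action_term :: "'n tm \<Rightarrow> bool" where
  "ground_action_term \<alpha> \<longleftrightarrow> wf_tm \<alpha> \<and> tm_sort \<alpha> = Act \<and> fv_tm \<alpha> = {}"

definition similar_at :: "'n tm \<Rightarrow> ('n, 'u) struct \<Rightarrow> ('n, 'u) struct \<Rightarrow> bool" where
  "similar_at S M M' \<longleftrightarrow>
     univ M Act = univ M' Act \<and> univ M Obj = univ M' Obj \<and>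
     (\<forall>f. sit_indep_fun f \<longrightarrow> (\<forall>ds \<in> tuples M (fargs f). fint M f ds = fint M' f ds)) \<and>
     (\<forall>p. sit_indep_pred p \<longrightarrow> (\<forall>ds \<in> tuples M (pargs p). rint M p ds = rint M' p ds)) \<and>
     (\<forall>F n e. (\<forall>i. ival e (Obj, i) \<in> univ M Obj) \<longrightarrow>
        (sat M (Rel (Fluent F n) (ovars [0..<n] @ [S])) e \<longleftrightarrow>
         sat M' (Rel (Fluent F n) (ovars [0..<n] @ [S])) e))"

definition is_progression ::
  "'u itself \<Rightarrow> 'n fm set \<Rightarrow> 'n fm set \<Rightarrow> 'n fm set \<Rightarrow> 'n fm set \<Rightarrow> 'n tm \<Rightarrow> 'n fm set \<Rightarrow> bool"
where
  "is_progression U Duna DS0 Dap Dss \<alpha> DS\<alpha> \<longleftrightarrow>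
     (\<forall>\<phi> \<in> DS\<alpha>. sentence \<phi> \<and> uniform (do_tm \<alpha> s0) \<phi>) \<and>
     (\<forall>M :: ('n, 'u) struct.
        is_struct M \<longrightarrow> models M (foundational \<union> Dss \<union> Dap \<union> Duna) \<longrightarrow>
        (models M DS\<alpha> \<longleftrightarrow>
         (\<exists>M' :: ('n, 'u) struct. is_struct M' \<and>
            models M' (foundational \<union> Duna \<union> DS0 \<union> Dap \<union> Dss) \<and>
            similar_at (do_tm \<alpha> s0) M M')))"

end

theory Submission
  imports Defs
begin

text \<open>The crux is that a fluent-free sentence entailed by the progressed initial theory (at
  \<open>S\<^sub>0\<close>) together with \<open>D\<^sub>u\<^sub>n\<^sub>a\<close> is already entailed by \<open>D\<^sub>S\<^sub>0\<close> together with \<open>D\<^sub>u\<^sub>n\<^sub>a\<close>. Given a model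
  \<open>M\<close> of the latter, replace its situations by the tree of all action sequences and read the
  fluents and \<open>Poss\<close> off the axioms: this is a model of the whole action theory, hence of the
  progression. Now overwrite the fluents of \<open>M\<close> by those of the tree after \<open>\<alpha>\<close>. As uniform
  sentences see nothing else of the situations, the result is a model of the progression at
  \<open>S\<^sub>0\<close>, and it differs from \<open>M\<close> in fluents only. The domain of situations of \<open>M\<close> is kept, because
  a fluent-free sentence may still quantify over situations.

  By parallel interpolation, a \<open>\<Delta>\<close>-consequence of \<open>D\<^sub>S\<^sub>0\<close> and \<open>D\<^sub>u\<^sub>n\<^sub>a\<close> follows from the
  \<open>\<Delta>\<close>-consequences of the components \<open>D\<^sub>i\<close>, which are the same for all \<open>i\<close> by inseparability, and
  these are consequences of each \<open>D'\<^sub>j\<close>.\<close>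

text \<open>The situations of the tree are finite sequences of actions and must fit into
  \<open>'u\<close>. Pairs embed into an infinite type, hence so do sequences of a fixed length; the
  length is coded alongside.\<close>

lemma list_encoding: "\<exists>enc :: 'u::infinite list \<Rightarrow> 'u. inj enc"
proof -
  have inf: "infinite (UNIV :: 'u set)"
    by (rule infinite_UNIV)
  from card_of_Times_same_infinite[OF this] obtain p :: "'u \<times> 'u \<Rightarrow> 'u" where p: "inj p"
    by (metis UNIV_Times_UNIV bij_betw_imp_inj_on card_of_ordIso)
  from infinite_countable_subset[OF inf] obtain c :: "nat \<Rightarrow> 'u" where c: "inj c"
    by blast
  \<comment> \<open>\<open>c 0\<close> is an arbitrary end marker: injectivity is needed only among
    lists of equal length.\<close>
  define fold where "fold = (\<lambda>l. foldr (\<lambda>x y. p (x, y)) l (c 0))"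
  have "l = l'" if "length l = length l'" "fold l = fold l'" for l l'
    using that by (induction l l' rule: list_induct2) (auto simp: fold_def dest: injD[OF p])
  then have "inj (\<lambda>l. p (c (length l), fold l))"
    by (intro injI) (auto dest!: injD[OF p] injD[OF c])
  then show ?thesis by blast
qed

section \<open>Basic facts on models, consequence and signatures\<close>

lemma models_union: "models M (T \<union> T') \<longleftrightarrow> models M T \<and> models M T'"
  by (auto simp: models_def)

lemma modelsD: "models M T \<Longrightarrow> \<phi> \<in> T \<Longrightarrow> models M {\<phi>}"
  by (auto simp: models_def)

lemma modelsI: "(\<And>\<phi>. \<phi> \<in> T \<Longrightarrow> models M {\<phi>}) \<Longrightarrow> models M T"
  by (auto simp: models_def)

lemma models_UN: "models M (\<Union>i \<in> I. T i) \<longleftrightarrow> (\<forall>i \<in> I. models M (T i))"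
  by (auto simp: models_def)

lemma models_sat: "models M {\<phi>} \<Longrightarrow> is_assignment M e \<Longrightarrow> sat M \<phi> e"
  by (auto simp: models_def)

lemma entails_cut: "entails_set U T T' \<Longrightarrow> entails U T' \<phi> \<Longrightarrow> entails U T \<phi>"
  by (auto simp: entails_def entails_set_def models_def)

lemma sig_Un: "sig (T \<union> T') = sig T \<union> sig T'"
  by (auto simp: sig_def)

lemma sig_UN: "sig (\<Union>i \<in> I. T i) = (\<Union>i \<in> I. sig (T i))"
  by (auto simp: sig_def)

section \<open>Coincidence\<close>

lemma is_assignment_ival:
  assumes "is_assignment M e" "d \<in> univ M (fst v)"
  shows "is_assignment M (e\<lparr>ival := (ival e)(v := d)\<rparr>)"
  using assms by (cases v) (auto simp: is_assignment_def)

text \<open>\<open>models\<close> reads free variables universally. This allows the axioms to be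
  checked as open formulas under an arbitrary assignment.\<close>

lemma models_Forall: "models M {Forall v \<phi>} \<longleftrightarrow> models M {\<phi>}"
proof
  assume l: "models M {Forall v \<phi>}"
  show "models M {\<phi>}"
    unfolding models_def
  proof clarsimp
    fix e assume e: "is_assignment M e"
    then have "ival e v \<in> univ M (fst v)" by (cases v) (auto simp: is_assignment_def)
    with models_sat[OF l e] have "sat M \<phi> (e\<lparr>ival := (ival e)(v := ival e v)\<rparr>)"
      unfolding sat.simps by blast
    then show "sat M \<phi> e" by simp
  qed
next
  assume "models M {\<phi>}"
  then show "models M {Forall v \<phi>}"
    by (auto simp: models_def intro: is_assignment_ival)
qed

lemma models_Alls: "models M {Alls vs \<phi>} \<longleftrightarrow> models M {\<phi>}"
  unfolding Alls_def by (induction vs) (simp_all add: models_Forall)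

lemma tm_val_cong:
  assumes "\<And>v. IV v \<in> fv_tm t \<Longrightarrow> ival e v = ival e' v"
    "\<And>v. FV v \<in> fv_tm t \<Longrightarrow> fval e v = fval e' v"
  shows "tm_val M e t = tm_val M e' t"
  using assms
proof (induction t)
  case (Fun f ts)
  then have "map (tm_val M e) ts = map (tm_val M e') ts" by fastforce
  then show ?case by (simp cong: map_cong)
next
  case (FunVar g ts)
  then have "map (tm_val M e) ts = map (tm_val M e') ts" by fastforce
  then show ?case using FunVar.prems(2)[of g] by (simp cong: map_cong)
qed auto

section \<open>Invariance of uniform formulas under a change of situations\<close>

fun nonsit :: "variable \<Rightarrow> bool" where
  "nonsit (IV v) = (fst v \<noteq> Sit)"
| "nonsit (RV R) = (Sit \<notin> set (fst R))"
| "nonsit (FV g) = (Sit \<notin> set (fst g) \<and> fst (snd g) \<noteq> Sit)"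

fun agree :: "'u assignment \<Rightarrow> 'u assignment \<Rightarrow> variable \<Rightarrow> bool" where
  "agree e e' (IV v) = (ival e v = ival e' v)"
| "agree e e' (RV R) = (rval e R = rval e' R)"
| "agree e e' (FV g) = (fval e g = fval e' g)"

text \<open>Interpretations agree as total functions, hence also on junk arguments, which spares
  checks that arguments lie in the right domains.\<close>

definition same_static :: "('n, 'u) struct \<Rightarrow> ('n, 'u) struct \<Rightarrow> bool" where
  "same_static M N \<longleftrightarrow> (\<forall>s. s \<noteq> Sit \<longrightarrow> univ M s = univ N s) \<and>
     (\<forall>f. sit_indep_fun f \<longrightarrow> fint M f = fint N f) \<and>
     (\<forall>p. sit_indep_pred p \<longrightarrow> rint M p = rint N p)"

lemma same_static_tuples:
  assumes "same_static M N" "Sit \<notin> set ss"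
  shows "tuples M ss = tuples N ss"
  using assms unfolding tuples_def same_static_def list_all2_conv_all_nth
  by (metis (no_types, lifting) nth_mem)

text \<open>Individual situation variables may be free, because the right-hand sides of axioms speak
  of \<open>svar 0\<close>; free relation and function variables must not involve
  situations.\<close>

definition proper_fv :: "variable set \<Rightarrow> bool" where
  "proper_fv V \<longleftrightarrow> (\<forall>v \<in> V. nonsit v \<or> (\<exists>x. v = IV x))"

lemma proper_fv_remove: "proper_fv (V - {w}) \<Longrightarrow> nonsit w \<Longrightarrow> proper_fv V"
  unfolding proper_fv_def by blast

lemma proper_fvD:
  "proper_fv V \<Longrightarrow> RV R \<in> V \<Longrightarrow> Sit \<notin> set (fst R)"
  "proper_fv V \<Longrightarrow> FV g \<in> V \<Longrightarrow> Sit \<notin> set (fst g) \<and> fst (snd g) \<noteq> Sit"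
  unfolding proper_fv_def by (drule (1) bspec, simp)+

lemma sort_in_sorts: "map tm_sort ts = ss \<Longrightarrow> t \<in> set ts \<Longrightarrow> tm_sort t \<in> set ss"
  by auto

text \<open>Terms whose value cannot depend on situations. The property passes to arguments:
  function symbols with a result other than a situation take object arguments only, and
  \<open>proper_fv\<close> takes care of function variables.\<close>

definition static_tm :: "'n tm \<Rightarrow> bool" where
  "static_tm t \<longleftrightarrow> wf_tm t \<and> tm_sort t \<noteq> Sit \<and> proper_fv (fv_tm t)"

lemma static_tm_args:
  assumes "map tm_sort ts = ss" "Sit \<notin> set ss" "\<And>t. t \<in> set ts \<Longrightarrow> wf_tm t"
    "proper_fv (\<Union>t \<in> set ts. fv_tm t)" "t \<in> set ts"
  shows "static_tm t"
  unfolding static_tm_def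
proof (intro conjI)
  have "tm_sort t \<in> set ss" using assms(1,5) by (rule sort_in_sorts)
  then show "tm_sort t \<noteq> Sit" using assms(2) by metis
  show "proper_fv (fv_tm t)" using assms(4,5) unfolding proper_fv_def by blast
qed (rule assms(3)[OF assms(5)])

lemma static_tm_Fun:
  assumes "static_tm (Fun f ts)"
  shows "sit_indep_fun f" "t \<in> set ts \<Longrightarrow> static_tm t"
proof -
  have f: "sit_indep_fun f" "Sit \<notin> set (fargs f)"
    using assms by (cases f; simp add: static_tm_def)+
  show "sit_indep_fun f" by (rule f)
  show "static_tm t" if "t \<in> set ts"
    by (rule static_tm_args[OF _ f(2) _ _ that]) (use assms in \<open>simp_all add: static_tm_def\<close>)
qed

lemma static_tm_FunVar:
  assumes "static_tm (FunVar g ts)"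
  shows "nonsit (FV g)" "t \<in> set ts \<Longrightarrow> static_tm t"
proof -
  have V: "proper_fv (fv_tm (FunVar g ts))" using assms unfolding static_tm_def by blast
  then show g: "nonsit (FV g)" by (simp add: proper_fv_def)
  show "static_tm t" if "t \<in> set ts"
    by (rule static_tm_args[OF _ _ _ _ that, of "fst g"])
      (use assms V g in \<open>simp_all add: static_tm_def proper_fv_def\<close>)
qed

lemma tm_val_static:
  assumes "same_static M N" "static_tm t"
    "\<And>v. v \<in> fv_tm t \<Longrightarrow> nonsit v \<Longrightarrow> agree e e' v"
  shows "tm_val M e t = tm_val N e' t"
  using assms(2-)
proof (induction t)
  case (Var v)
  then show ?case using Var.prems(2)[of "IV v"] by (cases v) (simp add: static_tm_def)
next
  case (Fun f ts)
  have "tm_val M e t = tm_val N e' t" if "t \<in> set ts" for t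
    by (rule Fun.IH[OF that static_tm_Fun(2)[OF Fun.prems(1) that]])
      (use Fun.prems(2) that in auto)
  then have "map (tm_val M e) ts = map (tm_val N e') ts" by simp
  then show ?case
    using static_tm_Fun(1)[OF Fun.prems(1)] assms(1)
    by (simp add: same_static_def cong: map_cong)
next
  case (FunVar g ts)
  have "tm_val M e t = tm_val N e' t" if "t \<in> set ts" for t
    by (rule FunVar.IH[OF that static_tm_FunVar(2)[OF FunVar.prems(1) that]])
      (use FunVar.prems(2) that in auto)
  then have "map (tm_val M e) ts = map (tm_val N e') ts" by simp
  then show ?case
    using FunVar.prems(2)[of "FV g"] static_tm_FunVar(1)[OF FunVar.prems(1)]
    by (simp cong: map_cong)
qed

text \<open>No subterm of a static term has sort situation, so \<open>S\<close> does not occur in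
  it.\<close>

lemma repl_tm_static:
  assumes "tm_sort S = Sit" "static_tm t"
  shows "repl_tm S S' t = t"
  using assms(2)
proof (induction t)
  case (Var v)
  then show ?case using assms(1) by (auto simp: static_tm_def)
next
  case (Fun f ts)
  have "map (repl_tm S S') ts = ts"
    using Fun.IH static_tm_Fun(2)[OF Fun.prems] by (simp add: map_idI)
  moreover have "Fun f ts \<noteq> S" using Fun.prems assms(1) unfolding static_tm_def by metis
  ultimately show ?case by simp
next
  case (FunVar g ts)
  have "map (repl_tm S S') ts = ts"
    using FunVar.IH static_tm_FunVar(2)[OF FunVar.prems] by (simp add: map_idI)
  moreover have "FunVar g ts \<noteq> S" using FunVar.prems assms(1) unfolding static_tm_def by metis
  ultimately show ?case by simp
qed

lemma repl_tm_self: "repl_tm S S t = t"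
  by (induction t) (auto intro: map_idI)

lemma repl_fm_self: "repl_fm S S \<phi> = \<phi>"
  by (induction \<phi>) (auto simp: repl_tm_self intro: map_idI)

text \<open>Covers \<open>s0\<close>, \<open>svar 0\<close>, and \<open>do_tm \<alpha> s0\<close>
  for ground \<open>\<alpha>\<close>. Having situation variables only, such a term keeps its value
  under every quantifier that a uniform formula admits.\<close>

definition sit_term :: "'n tm \<Rightarrow> bool" where
  "sit_term S \<longleftrightarrow> tm_sort S = Sit \<and> (\<forall>v \<in> fv_tm S. \<exists>i. v = IV (Sit, i))"

lemma sit_term_tm_val:
  assumes "sit_term S"
  shows "fst v \<noteq> Sit \<Longrightarrow> tm_val M (e\<lparr>ival := (ival e)(v := d)\<rparr>) S = tm_val M e S"
    "tm_val M (e\<lparr>rval := Rs\<rparr>) S = tm_val M e S"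
    "tm_val M (e\<lparr>fval := Fs\<rparr>) S = tm_val M e S"
  using assms unfolding sit_term_def by (fastforce intro!: tm_val_cong)+

text \<open>A formula uniform in \<open>S\<close> sees no more of the situations than the fluents at \<open>S\<close>.\<close>

lemma uniform_transfer:
  assumes st: "same_static M N" and S: "sit_term S" and S': "sit_term S'"
    and "\<And>F n ds. PSym (Fluent F n) \<in> sig_fm \<phi> \<Longrightarrow> length ds = n \<Longrightarrow>
        rint M (Fluent F n) (ds @ [tm_val M e S]) = rint N (Fluent F n) (ds @ [tm_val N e' S'])"
    and "wf_fm \<phi>" "uniform S \<phi>" "proper_fv (fv \<phi>)"
    and "\<And>v. v \<in> fv \<phi> \<Longrightarrow> nonsit v \<Longrightarrow> agree e e' v"
  shows "sat M \<phi> e \<longleftrightarrow> sat N (repl_fm S S' \<phi>) e'"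
proof -
  have arg: "tm_val M e t = tm_val N e' (repl_tm S S' t)"
    if "static_tm t" "\<And>v. v \<in> fv_tm t \<Longrightarrow> nonsit v \<Longrightarrow> agree e e' v" for t e e'
    using tm_val_static[OF st, of t e e'] repl_tm_static[of S t S'] that S
    by (simp add: sit_term_def)
  show ?thesis
    using assms(4-)
  proof (induction \<phi> arbitrary: e e')
    case Fls
    then show ?case by simp
  next
    case (Eq t u)
    have "static_tm t" "static_tm u" using Eq.prems(2-4) by (auto simp: static_tm_def proper_fv_def)
    moreover have "agree e e' v" if "v \<in> fv_tm t \<union> fv_tm u" "nonsit v" for v
      using Eq.prems(5) that by simp
    ultimately have "tm_val M e t = tm_val N e' (repl_tm S S' t)"
      "tm_val M e u = tm_val N e' (repl_tm S S' u)"
      by (simp_all add: arg)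
    then show ?case by simp
  next
    case (Rel p ts)
    \<comment> \<open>Stated for sublists of \<open>ts\<close>: the last argument of a fluent is
      \<open>S\<close>, which is not static.\<close>
    have args: "map (tm_val M e) us = map (tm_val N e') (map (repl_tm S S') us)"
      if us: "set us \<subseteq> set ts" "map tm_sort us = ss" "Sit \<notin> set ss" for us ss
    proof -
      have "tm_val M e t = tm_val N e' (repl_tm S S' t)" if t: "t \<in> set us" for t
      proof (rule arg)
        show "static_tm t"
        proof (rule static_tm_args[OF us(2,3) _ _ t])
          show "wf_tm u" if "u \<in> set us" for u using Rel.prems(2) us(1) that by auto
          show "proper_fv (\<Union> (fv_tm ` set us))"
            using Rel.prems(4) us(1) unfolding proper_fv_def fv.simps by blast
        qed
        show "agree e e' v" if "v \<in> fv_tm t" "nonsit v" for v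
          using Rel.prems(5)[of v] t us(1) that by auto
      qed
      then show ?thesis by simp
    qed
    show ?case
    proof (cases p)
      case (Fluent F n)
      have last: "last ts = S" using Rel.prems(3) Fluent by simp
      have sorts: "map tm_sort ts = replicate n Obj @ [Sit]" using Rel.prems(2) Fluent by simp
      then have "ts \<noteq> []" by auto
      then obtain us where ts: "ts = us @ [S]" using last append_butlast_last_id by metis
      have us: "map tm_sort us = replicate n Obj" using sorts ts by simp
      then have len: "length us = n" by (metis length_map length_replicate)
      have eq: "map (tm_val M e) us = map (tm_val N e') (map (repl_tm S S') us)"
        by (rule args[OF _ us]) (auto simp: ts)
      have "repl_tm S S' S = S'" by (cases S) auto
      then show ?thesis using Rel.prems(1)[of F n "map (tm_val M e) us"] len
        by (simp add: Fluent ts eq del: map_map)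
    next
      case (SPred q n)
      have "map (tm_val M e) ts = map (tm_val N e') (map (repl_tm S S') ts)"
        by (rule args[of _ "replicate n Obj"]) (use Rel.prems(2) SPred in simp_all)
      moreover have "rint M p = rint N p" using st SPred by (simp add: same_static_def)
      ultimately show ?thesis by (simp del: map_map)
    qed (use Rel.prems(3) in auto)
  next
    case (RelVar R ts)
    have R: "Sit \<notin> set (fst R)" by (rule proper_fvD(1)[OF RelVar.prems(4)]) simp
    have "tm_val M e t = tm_val N e' (repl_tm S S' t)" if t: "t \<in> set ts" for t
    proof (rule arg)
      show "static_tm t"
        by (rule static_tm_args[OF _ R _ _ t])
          (use RelVar.prems(2,4) in \<open>simp_all add: proper_fv_def\<close>)
      show "agree e e' v" if "v \<in> fv_tm t" "nonsit v" for v
        using RelVar.prems(5)[of v] t that by auto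
    qed
    then have "map (tm_val M e) ts = map (tm_val N e') (map (repl_tm S S') ts)" by simp
    moreover have "rval e R = rval e' R" using RelVar.prems(5)[of "RV R"] R by simp
    ultimately show ?case by (simp del: map_map)
  next
    case (Imp \<phi> \<psi>)
    have "proper_fv (fv \<phi>)" "proper_fv (fv \<psi>)" using Imp.prems by (auto simp: proper_fv_def)
    then show ?case using Imp.prems Imp.IH[of e e'] by auto
  next
    case (Forall v \<phi>)
    have v: "fst v \<noteq> Sit" using Forall.prems by simp
    have "univ M (fst v) = univ N (fst v)" using st v by (simp add: same_static_def)
    moreover have "sat M \<phi> (e\<lparr>ival := (ival e)(v := d)\<rparr>) \<longleftrightarrow>
        sat N (repl_fm S S' \<phi>) (e'\<lparr>ival := (ival e')(v := d)\<rparr>)" for d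
    proof (rule Forall.IH)
      show "proper_fv (fv \<phi>)"
        using Forall.prems(4) v by (auto intro: proper_fv_remove)
      show "agree (e\<lparr>ival := (ival e)(v := d)\<rparr>) (e'\<lparr>ival := (ival e')(v := d)\<rparr>) w"
        if "w \<in> fv \<phi>" "nonsit w" for w
        using Forall.prems(5)[of w] that by (cases w) auto
    qed (use Forall.prems v in \<open>auto simp: sit_term_tm_val(1)[OF S] sit_term_tm_val(1)[OF S']\<close>)
    ultimately show ?case by simp
  next
    case (ForallR R \<phi>)
    have "sat M \<phi> (e\<lparr>rval := (rval e)(R := Q)\<rparr>) \<longleftrightarrow>
        sat N (repl_fm S S' \<phi>) (e'\<lparr>rval := (rval e')(R := Q)\<rparr>)" for Q
    proof (rule ForallR.IH)
      show "proper_fv (fv \<phi>)"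
        using ForallR.prems(3,4) by (auto intro: proper_fv_remove)
      show "agree (e\<lparr>rval := (rval e)(R := Q)\<rparr>) (e'\<lparr>rval := (rval e')(R := Q)\<rparr>) w"
        if "w \<in> fv \<phi>" "nonsit w" for w
        using ForallR.prems(5)[of w] that by (cases w) auto
    qed (use ForallR.prems in \<open>auto simp: sit_term_tm_val(2)[OF S] sit_term_tm_val(2)[OF S']\<close>)
    then show ?case by simp
  next
    case (ForallF g \<phi>)
    have g: "Sit \<notin> set (fst g)" "fst (snd g) \<noteq> Sit" using ForallF.prems by simp_all
    \<comment> \<open>The sorts of \<open>g\<close> avoid situations, whose domains may differ, so
      \<open>h\<close> ranges over the same functions on both sides.\<close>
    have "tuples M (fst g) = tuples N (fst g)" "univ M (fst (snd g)) = univ N (fst (snd g))"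
      using same_static_tuples[OF st g(1)] st g(2) by (simp_all add: same_static_def)
    moreover have "sat M \<phi> (e\<lparr>fval := (fval e)(g := h)\<rparr>) \<longleftrightarrow>
        sat N (repl_fm S S' \<phi>) (e'\<lparr>fval := (fval e')(g := h)\<rparr>)" for h
    proof (rule ForallF.IH)
      show "proper_fv (fv \<phi>)"
        using ForallF.prems(4) g by (auto intro: proper_fv_remove)
      show "agree (e\<lparr>fval := (fval e)(g := h)\<rparr>) (e'\<lparr>fval := (fval e')(g := h)\<rparr>) w"
        if "w \<in> fv \<phi>" "nonsit w" for w
        using ForallF.prems(5)[of w] that by (cases w) auto
    qed (use ForallF.prems in \<open>auto simp: sit_term_tm_val(3)[OF S] sit_term_tm_val(3)[OF S']\<close>)
    ultimately show ?case by simp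
  qed
qed

section \<open>Dependence of truth on the occurring symbols only\<close>

lemma tm_val_reduct:
  assumes "\<And>f. FSym f \<in> sig_tm t \<Longrightarrow> fint M f = fint N f"
  shows "tm_val M e t = tm_val N e t"
  using assms
proof (induction t)
  case (Fun f ts)
  then have "map (tm_val M e) ts = map (tm_val N e) ts" by auto
  then show ?case using Fun.prems by (simp cong: map_cong)
next
  case (FunVar g ts)
  then have "map (tm_val M e) ts = map (tm_val N e) ts" by auto
  then show ?case by (simp cong: map_cong)
qed auto

text \<open>In contrast to \<open>uniform_transfer\<close>, the formula is arbitrary and may
  quantify over situations, at the price of equal domains for all sorts.\<close>

lemma sat_reduct:
  assumes "univ M = univ N" "\<And>f. FSym f \<in> sig_fm \<phi> \<Longrightarrow> fint M f = fint N f"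
    "\<And>p. PSym p \<in> sig_fm \<phi> \<Longrightarrow> rint M p = rint N p"
  shows "sat M \<phi> e \<longleftrightarrow> sat N \<phi> e"
  using assms(2,3)
proof (induction \<phi> arbitrary: e)
  case (Eq t u)
  then show ?case using tm_val_reduct[of t M N e] tm_val_reduct[of u M N e] by auto
next
  case (Rel p ts)
  then have "map (tm_val M e) ts = map (tm_val N e) ts" by (auto intro!: tm_val_reduct)
  then show ?case using Rel.prems by (simp cong: map_cong)
next
  case (RelVar R ts)
  then have "map (tm_val M e) ts = map (tm_val N e) ts" by (auto intro!: tm_val_reduct)
  then show ?case by (simp cong: map_cong)
qed (auto simp: assms(1) tuples_def)


section \<open>Inseparable components\<close>

lemma entails_Consq: "entails_set U T (Consq U L T \<Delta>)"
  by (simp add: Consq_def entails_set_def)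

lemma interpolant_subset_Consq:
  assumes "T' \<subseteq> L" "entails_set U T T'" "sig T' \<subseteq> \<Delta>"
  shows "T' \<subseteq> Consq U L T \<Delta>"
  using assms by (auto simp: Consq_def sig_def entails_set_def)

text \<open>Induction splits off one theory at a time by interpolation for pairs. The interpolant of
  \<open>T k\<close> consists of \<open>\<Delta>\<close>-consequences, which lie in
  \<open>C\<close>; each member of the other interpolant is again a \<open>\<Delta>\<close>-sentence
  of \<open>L\<close>, to which the induction hypothesis applies in place of
  \<open>\<phi>\<close>.\<close>

lemma interpolation_finite:
  assumes pip: "has_PIP U L" and "finite K"
    and T: "\<And>k. k \<in> K \<Longrightarrow> T k \<subseteq> L"
    and sigs: "\<And>i j. i \<in> K \<Longrightarrow> j \<in> K \<Longrightarrow> i \<noteq> j \<Longrightarrow> sig (T i) \<inter> sig (T j) \<subseteq> \<Delta>"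
    and C: "\<And>k. k \<in> K \<Longrightarrow> Consq U L (T k) \<Delta> \<subseteq> C"
    and \<phi>: "\<phi> \<in> L" "sig_fm \<phi> \<subseteq> \<Delta>" "entails U (\<Union>k \<in> K. T k) \<phi>"
  shows "entails U C \<phi>"
  using \<open>finite K\<close> T sigs C \<phi>
proof (induction K arbitrary: \<phi> rule: finite_induct)
  case empty
  then show ?case by (auto simp: entails_def models_def)
next
  case (insert k K)
  let ?T = "\<Union>k \<in> K. T k"
  let ?\<Delta> = "sig (T k) \<inter> sig ?T"
  have \<Delta>: "?\<Delta> \<subseteq> \<Delta>"
  proof -
    have "sig (T k) \<inter> sig (T j) \<subseteq> \<Delta>" if "j \<in> K" for j
      using insert.prems(2)[of k j] insert.hyps that by auto
    then show ?thesis by (auto simp: sig_UN)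
  qed
  have "T k \<subseteq> L" "?T \<subseteq> L" using insert.prems(1) by auto
  moreover have "entails U (T k \<union> ?T) \<phi>" using insert.prems(6) by simp
  ultimately obtain T1 T2 where L: "T1 \<subseteq> L" "T2 \<subseteq> L"
    and e: "entails_set U (T k) T1" "entails_set U ?T T2" "entails U (T1 \<union> T2) \<phi>"
    and s: "sig T1 - ?\<Delta> \<subseteq> (sig (T k) \<inter> sig_fm \<phi>) - ?\<Delta>" "sig T2 - ?\<Delta> \<subseteq> (sig ?T \<inter> sig_fm \<phi>) - ?\<Delta>"
    using pip[unfolded has_PIP_def, rule_format, of "T k" ?T ?\<Delta> \<phi>] insert.prems(4) by blast
  \<comment> \<open>Beyond the shared symbols an interpolant uses only symbols of
    \<open>\<phi>\<close>, and both kinds lie in \<open>\<Delta>\<close>.\<close>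
  have sig: "sig T1 \<subseteq> \<Delta>" "sig T2 \<subseteq> \<Delta>" using s \<Delta> insert.prems(5) by blast+
  have "T1 \<subseteq> C" using interpolant_subset_Consq[OF L(1) e(1) sig(1)] insert.prems(3)[of k] by blast
  moreover have "entails U C \<psi>" if "\<psi> \<in> T2" for \<psi>
  proof (rule insert.IH)
    show "\<psi> \<in> L" using L that by blast
    show "sig_fm \<psi> \<subseteq> \<Delta>" using sig(2) that by (auto simp: sig_def)
    show "entails U ?T \<psi>" using e(2) that by (simp add: entails_set_def)
  qed (use insert.prems in auto)
  ultimately have "entails_set U C (T1 \<union> T2)"
    by (auto simp: entails_set_def entails_def models_def)
  then show ?case using e(3) by (rule entails_cut)
qed

text \<open>A single application yields all interpolants at once, so infinite families are covered
  without compactness.\<close>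

lemma interpolation_family:
  assumes pip: "has_PIP_family U L I"
    and T: "\<And>k. k \<in> I \<Longrightarrow> T k \<subseteq> L"
    and sigs: "\<And>i j. i \<in> I \<Longrightarrow> j \<in> I \<Longrightarrow> i \<noteq> j \<Longrightarrow> sig (T i) \<inter> sig (T j) = \<Delta>"
    and C: "\<And>k. k \<in> I \<Longrightarrow> Consq U L (T k) \<Delta> \<subseteq> C"
    and \<phi>: "\<phi> \<in> L" "sig_fm \<phi> \<subseteq> \<Delta>" "entails U (\<Union>k \<in> I. T k) \<phi>"
  shows "entails U C \<phi>"
proof -
  obtain T' where T': "\<forall>i \<in> I. T' i \<subseteq> L" "\<forall>i \<in> I. entails_set U (T i) (T' i)"
    "entails U (\<Union>i \<in> I. T' i) \<phi>" "\<forall>i \<in> I. sig (T' i) - \<Delta> \<subseteq> (sig (T i) \<inter> sig_fm \<phi>) - \<Delta>"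
    using pip[unfolded has_PIP_family_def, rule_format, of T \<Delta> \<phi>] T sigs \<phi> by blast
  have "T' i \<subseteq> C" if "i \<in> I" for i
  proof -
    have "sig (T' i) \<subseteq> \<Delta>" using T'(4) \<phi>(2) that by blast
    then show ?thesis using interpolant_subset_Consq[of "T' i" L U "T i" \<Delta>] T' C that by blast
  qed
  then have "entails_set U C (\<Union>i \<in> I. T' i)"
    by (auto simp: entails_set_def entails_def models_def)
  then show ?thesis using T'(3) by (rule entails_cut)
qed


section \<open>Syntax of the axioms\<close>

lemma sig_Alls: "sig_fm (Alls vs \<phi>) = sig_fm \<phi>"
  by (induction vs) (simp_all add: Alls_def)

lemma uniform_Alls: "uniform S (Alls vs \<phi>) \<longleftrightarrow> (\<forall>v \<in> set vs. fst v \<noteq> Sit) \<and> uniform S \<phi>"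
  by (induction vs) (simp_all add: Alls_def)

lemma Exs_syntax:
  "wf_fm (Exs vs \<phi>) \<longleftrightarrow> wf_fm \<phi>"
  "uniform S (Exs vs \<phi>) \<longleftrightarrow> (\<forall>v \<in> set vs. fst v \<noteq> Sit) \<and> uniform S \<phi>"
  "fv (Exs vs \<phi>) = fv \<phi> - IV ` set vs"
  by (induction vs) (auto simp: Exs_def)

lemma Disjs_syntax:
  "wf_fm (Disjs \<phi>s) \<longleftrightarrow> (\<forall>\<phi> \<in> set \<phi>s. wf_fm \<phi>)"
  "uniform S (Disjs \<phi>s) \<longleftrightarrow> (\<forall>\<phi> \<in> set \<phi>s. uniform S \<phi>)"
  "fv (Disjs \<phi>s) = (\<Union>\<phi> \<in> set \<phi>s. fv \<phi>)"
  by (induction \<phi>s) (auto simp: Disjs_def)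

lemma Conjs_syntax:
  "uniform S (Conjs \<phi>s) \<longleftrightarrow> (\<forall>\<phi> \<in> set \<phi>s. uniform S \<phi>)"
  "sig_fm (Conjs \<phi>s) = (\<Union>\<phi> \<in> set \<phi>s. sig_fm \<phi>)"
  "sat M (Conjs \<phi>s) e \<longleftrightarrow> (\<forall>\<phi> \<in> set \<phi>s. sat M \<phi> e)"
  by (induction \<phi>s) (auto simp: Conjs_def)

text \<open>The equalities are between objects or between actions, and only objects are quantified,
  so \<open>S\<close> may be any term.\<close>

lemma una_axioms_uniform: "\<phi> \<in> una_axioms Sg \<Longrightarrow> uniform S \<phi>"
  by (auto simp: una_axioms_def uniform_Alls Conjs_syntax ovars_def set_zip)

lemma una_axioms_fluent_free: "\<phi> \<in> una_axioms Sg \<Longrightarrow> PSym p \<notin> sig_fm \<phi>"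
  by (auto simp: una_axioms_def sig_Alls Conjs_syntax ovars_def set_zip)

definition axiom_vars :: "nat \<Rightarrow> variable set" where
  "axiom_vars n = {IV (Act, 0), IV (Sit, 0)} \<union> (\<lambda>i. IV (Obj, i)) ` {..<n}"

lemma proper_axiom_vars: "V \<subseteq> axiom_vars n \<Longrightarrow> proper_fv V"
  unfolding proper_fv_def axiom_vars_def by blast

lemma effect_syntax:
  assumes "wf_effect n E"
  shows "wf_fm (effect_fm E)" "uniform (svar 0) (effect_fm E)" "fv (effect_fm E) \<subseteq> axiom_vars n"
proof -
  obtain ys A ts \<phi> where E: "E = Effect ys A ts \<phi>" by (cases E)
  have ts: "\<forall>t \<in> set ts. wf_tm t \<and> tm_sort t = Obj \<and>
      fv_tm t \<subseteq> (\<lambda>i. IV (Obj, i)) ` ({..<n} \<union> set ys)"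
    and \<phi>: "wf_fm \<phi>" "uniform (svar 0) \<phi>"
      "fv \<phi> \<subseteq> insert (IV (Sit, 0)) ((\<lambda>i. IV (Obj, i)) ` ({..<n} \<union> set ys))"
    using assms E by auto
  have "map tm_sort ts = replicate (length ts) Obj"
    using ts by (induction ts) auto
  then show "wf_fm (effect_fm E)" using ts \<phi>(1) by (simp add: E Exs_syntax avar_def)
  show "uniform (svar 0) (effect_fm E)" using \<phi>(2) by (auto simp: E Exs_syntax avar_def)
  have "(\<Union>t \<in> set ts. fv_tm t) \<subseteq> (\<lambda>i. IV (Obj, i)) ` ({..<n} \<union> set ys)" using ts by blast
  then show "fv (effect_fm E) \<subseteq> axiom_vars n"
    using \<phi>(3) by (auto simp: E Exs_syntax avar_def axiom_vars_def)
qed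

text \<open>Split off from \<open>ss_axiom\<close> because it doubles as the recursion step for
  fluents along a sequence of actions.\<close>

definition ss_rhs :: "'n \<Rightarrow> nat \<Rightarrow> 'n effect list \<Rightarrow> 'n effect list \<Rightarrow> 'n fm" where
  "ss_rhs F n pos neg = Disj (Disjs (map effect_fm pos))
     (Conj (Rel (Fluent F n) (ovars [0..<n] @ [svar 0])) (Neg (Disjs (map effect_fm neg))))"

lemma ss_rhs_syntax:
  assumes "\<forall>E \<in> set pos \<union> set neg. wf_effect n E"
  shows "wf_fm (ss_rhs F n pos neg)" "uniform (svar 0) (ss_rhs F n pos neg)"
    "fv (ss_rhs F n pos neg) \<subseteq> axiom_vars n"
proof -
  have "map tm_sort (ovars [0..<n]) = replicate n Obj"
    by (simp add: ovars_def comp_def map_replicate_const)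
  then show "wf_fm (ss_rhs F n pos neg)" "uniform (svar 0) (ss_rhs F n pos neg)"
    using assms effect_syntax[of n]
    by (auto simp: ss_rhs_def Disjs_syntax ovars_def svar_def comp_def)
  have "(\<Union>E \<in> set pos \<union> set neg. fv (effect_fm E)) \<subseteq> axiom_vars n"
    using assms effect_syntax(3) by blast
  then show "fv (ss_rhs F n pos neg) \<subseteq> axiom_vars n"
    by (auto simp: ss_rhs_def Disjs_syntax ovars_def svar_def axiom_vars_def)
qed


section \<open>The tree of situations\<close>

text \<open>Variables other than the object arguments and the action variable get default values.
  The situation variable gets an arbitrary situation, which is harmless where fluents ignore their
  situation argument.\<close>

definition env :: "('n, 'u) struct \<Rightarrow> 'u list \<Rightarrow> 'u \<Rightarrow> 'u assignment" where
  "env M xs a = \<lparr>ival = (\<lambda>v. if fst v = Obj \<and> snd v < length xs then xs ! snd v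
       else if v = (Act, 0) then a else (SOME d. d \<in> univ M (fst v))),
     rval = (\<lambda>_ _. False), fval = (\<lambda>g _. SOME d. d \<in> univ M (fst (snd g)))\<rparr>"

lemma is_assignment_env:
  assumes "is_struct M" "set xs \<subseteq> univ M Obj" "a \<in> univ M Act"
  shows "is_assignment M (env M xs a)"
proof -
  have "(SOME d. d \<in> univ M s) \<in> univ M s" for s
    using assms(1) by (simp add: is_struct_def some_in_eq)
  then show ?thesis using assms(2,3) by (auto simp: is_assignment_def env_def)
qed

lemma ex_assignment:
  assumes "is_struct M"
  obtains e where "is_assignment M e"
  using is_assignment_env[of M "[]" "SOME a. a \<in> univ M Act"] assms
  by (auto simp: is_struct_def some_in_eq)

text \<open>The truth of a sentence does not depend on the assignment, so unrelated assignments can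
  be compared; each structure has one because its domains are nonempty.\<close>

lemma sentence_transfer:
  assumes st: "same_static M N" "is_struct M" "is_struct N" and S: "sit_term S" "sit_term S'"
    and \<phi>: "sentence \<phi>" "uniform S \<phi>"
    and fl: "\<And>F n ds e e'. PSym (Fluent F n) \<in> sig_fm \<phi> \<Longrightarrow> length ds = n \<Longrightarrow>
        rint M (Fluent F n) (ds @ [tm_val M e S]) = rint N (Fluent F n) (ds @ [tm_val N e' S'])"
  shows "models M {\<phi>} \<longleftrightarrow> models N {repl_fm S S' \<phi>}"
proof -
  have "sat M \<phi> e \<longleftrightarrow> sat N (repl_fm S S' \<phi>) e'" for e e'
    using \<phi> by (intro uniform_transfer[OF st(1) S fl]) (auto simp: sentence_def proper_fv_def)
  then show ?thesis unfolding models_def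
    using ex_assignment[OF st(2)] ex_assignment[OF st(3)] by (metis singletonD singletonI)
qed

text \<open>Fluents are given by \<open>X\<close> and ignore their situation argument.\<close>

definition local_struct ::
  "('n, 'u) struct \<Rightarrow> ('n \<Rightarrow> nat \<Rightarrow> 'u list \<Rightarrow> bool) \<Rightarrow> ('n, 'u) struct" where
  "local_struct M X = M\<lparr>rint := (\<lambda>p ds. case p of
     Fluent F n \<Rightarrow> X F n (butlast ds) | _ \<Rightarrow> rint M p ds)\<rparr>"

lemma local_struct_simps [simp]:
  "univ (local_struct M X) = univ M"
  "fint (local_struct M X) = fint M"
  "rint (local_struct M X) (Fluent F n) ds = X F n (butlast ds)"
  "rint (local_struct M X) (SPred q n) = rint M (SPred q n)"
  by (simp_all add: local_struct_def)

lemma is_struct_local: "is_struct (local_struct M X) \<longleftrightarrow> is_struct M"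
  by (simp add: is_struct_def tuples_def)

lemma same_static_local: "same_static M N \<Longrightarrow> same_static M (local_struct N X)"
  unfolding same_static_def by (auto simp: local_struct_def elim!: sit_indep_pred.elims)

lemma same_static_sym: "same_static M N \<Longrightarrow> same_static N M"
  by (simp add: same_static_def)

text \<open>Overwriting fluents changes neither the domains nor any other symbol, so
  \<open>\<phi>\<close> may even quantify over situations.\<close>

lemma local_struct_fluent_free:
  assumes "\<And>F n. PSym (Fluent F n) \<notin> sig_fm \<phi>"
  shows "models (local_struct M X) {\<phi>} \<longleftrightarrow> models M {\<phi>}"
proof -
  have "rint (local_struct M X) p = rint M p" if "PSym p \<in> sig_fm \<phi>" for p
    using that assms by (cases p) (auto simp: local_struct_def)
  then have "sat (local_struct M X) \<phi> e \<longleftrightarrow> sat M \<phi> e" for e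
    by (intro sat_reduct) auto
  then show ?thesis by (simp add: models_def is_assignment_def tuples_def)
qed

text \<open>The fluents after a list of actions, latest action first, where \<open>G F n\<close> is the right-hand
  side of the successor state axiom of \<open>F\<close>.\<close>

primrec fluents_after ::
  "('n, 'u) struct \<Rightarrow> ('n \<Rightarrow> nat \<Rightarrow> 'n fm) \<Rightarrow> 'u list \<Rightarrow> 'n \<Rightarrow> nat \<Rightarrow> 'u list \<Rightarrow> bool" where
  "fluents_after M G [] = (\<lambda>F n xs. rint M (Fluent F n) (xs @ [fint M S0 []]))"
| "fluents_after M G (a # l) =
     (\<lambda>F n xs. sat (local_struct M (fluents_after M G l)) (G F n) (env M xs a))"

locale situation_tree =
  fixes M :: "('n, 'u) struct" and enc :: "'u list \<Rightarrow> 'u" and Sg :: "'n symbol set"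
    and \<Pi> G :: "'n \<Rightarrow> nat \<Rightarrow> 'n fm"
  assumes M: "is_struct M" and inj_enc: "inj enc" and una: "models M (una_axioms Sg)"
begin

definition dec :: "'u \<Rightarrow> 'u list" where "dec = inv enc"

lemma dec_enc [simp]: "dec (enc l) = l"
  using inj_enc by (simp add: dec_def)

text \<open>The snapshot after the actions \<open>l\<close>, on the domains of \<open>M\<close>.
  Evaluating formulas in snapshots lets the fluents be computed before the tree exists.\<close>

definition here :: "'u list \<Rightarrow> ('n, 'u) struct" where
  "here l = local_struct M (fluents_after M G l)"

text \<open>Sequences carry the latest action first, so \<open>Preceq\<close> is the suffix
  relation. \<open>Poss\<close> fails for elements that are not values of an action function in
  \<open>Sg\<close>.\<close>

fun tree_rint :: "'n psym \<Rightarrow> 'u list \<Rightarrow> bool" where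
  "tree_rint Preceq ds = (\<exists>l. dec (ds ! 1) = l @ dec (ds ! 0))"
| "tree_rint Poss ds = (\<exists>A n xs. FSym (Action A n) \<in> Sg \<and> xs \<in> tuples M (replicate n Obj) \<and>
     ds ! 0 = fint M (Action A n) xs \<and> sat (here (dec (ds ! 1))) (\<Pi> A n) (env M xs (ds ! 0)))"
| "tree_rint (Fluent F n) ds = fluents_after M G (dec (last ds)) F n (butlast ds)"
| "tree_rint (SPred q n) ds = rint M (SPred q n) ds"

text \<open>Coded sequences may coincide with elements of other sorts, as domains need not be
  disjoint.\<close>

definition tree :: "('n, 'u) struct" where
  "tree = \<lparr>univ = (univ M)(Sit := enc ` lists (univ M Act)),
     fint = (fint M)(S0 := \<lambda>_. enc [], Do := \<lambda>ds. enc (ds ! 0 # dec (ds ! 1))),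
     rint = tree_rint\<rparr>"

lemma tree_univ [simp]: "univ tree Act = univ M Act" "univ tree Obj = univ M Obj"
  "univ tree Sit = enc ` lists (univ M Act)"
  by (simp_all add: tree_def)

lemma tree_rint_eq [simp]: "rint tree = tree_rint"
  by (simp add: tree_def)

lemma tree_fint [simp]: "fint tree S0 ds = enc []" "fint tree Do ds = enc (ds ! 0 # dec (ds ! 1))"
  "sit_indep_fun f \<Longrightarrow> fint tree f = fint M f"
  by (auto simp: tree_def)

lemma tree_do [simp]: "tm_val tree e (do_tm a s) = enc (tm_val tree e a # dec (tm_val tree e s))"
  by (simp add: do_tm_def)

lemma tree_s0 [simp]: "tm_val tree e s0 = enc []"
  by (simp add: s0_def)

lemma same_static_tree: "same_static M tree"
  unfolding same_static_def
proof (intro conjI allI impI)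
  show "univ M s = univ tree s" if "s \<noteq> Sit" for s using that by (simp add: tree_def)
  show "rint M p = rint tree p" if "sit_indep_pred p" for p using that by (cases p) auto
qed simp

lemma is_struct_tree: "is_struct tree"
  unfolding is_struct_def
proof (intro conjI allI ballI)
  fix f :: "'n fsym" and ds assume ds: "ds \<in> tuples tree (fargs f)"
  show "fint tree f ds \<in> univ tree (fres f)"
  proof (cases "sit_indep_fun f")
    case True
    then have "Sit \<notin> set (fargs f)" "fres f \<noteq> Sit" by (cases f; simp)+
    then have "tuples tree (fargs f) = tuples M (fargs f)" "univ tree (fres f) = univ M (fres f)"
      using same_static_tuples[OF same_static_tree] same_static_tree
      by (simp_all add: same_static_def)
    then show ?thesis using M ds True by (simp add: is_struct_def)
  next
    case False
    then show ?thesis using ds by (cases f) (auto simp: tuples_def list_all2_Cons2 intro!: imageI)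
  qed
qed (use M in \<open>auto simp: is_struct_def tree_def\<close>)

lemma tree_assignment:
  assumes "is_assignment tree e"
  shows "ival e (Obj, i) \<in> univ M Obj" "ival e (Act, i) \<in> univ M Act"
    "\<exists>l \<in> lists (univ M Act). ival e (Sit, i) = enc l"
  using assms unfolding is_assignment_def by (metis tree_univ imageE)+

text \<open>Injectivity of \<open>enc\<close> yields the first axiom, the empty list being its own
  only suffix the second, and induction on lists the second-order axiom.\<close>

lemma tree_foundational: "models tree foundational"
proof -
  have inj: "enc l = enc l' \<longleftrightarrow> l = l'" for l l' using inj_enc by (simp add: inj_eq)
  have "models tree {Imp (Eq (do_tm (avar 1) (svar 1)) (do_tm (avar 2) (svar 2)))
      (Conj (Eq (avar 1) (avar 2)) (Eq (svar 1) (svar 2)))}"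
    unfolding models_def
  proof clarify
    fix e assume e: "is_assignment tree e"
    show "sat tree (Imp (Eq (do_tm (avar 1) (svar 1)) (do_tm (avar 2) (svar 2)))
      (Conj (Eq (avar 1) (avar 2)) (Eq (svar 1) (svar 2)))) e"
      using tree_assignment(3)[OF e, of 1] tree_assignment(3)[OF e, of 2]
      by (auto simp: inj avar_def svar_def)
  qed
  moreover have "models tree {Neg (Conj (preceq (svar 0) s0) (Neg (Eq (svar 0) s0)))}"
    unfolding models_def
  proof clarify
    fix e assume e: "is_assignment tree e"
    show "sat tree (Neg (Conj (preceq (svar 0) s0) (Neg (Eq (svar 0) s0)))) e"
      using tree_assignment(3)[OF e, of 0] by (auto simp: svar_def preceq_def)
  qed
  moreover have "models tree {Iff (preceq (svar 1) (svar 2))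
      (Disj (Exists (Act, 0) (preceq (do_tm (avar 0) (svar 1)) (svar 2))) (Eq (svar 1) (svar 2)))}"
    unfolding models_def
  proof clarify
    fix e assume e: "is_assignment tree e"
    obtain l1 l2 where l: "ival e (Sit, 1) = enc l1" "ival e (Sit, 2) = enc l2"
      "l2 \<in> lists (univ M Act)"
      using tree_assignment(3)[OF e] by metis
    have "(\<exists>l. l2 = l @ l1) \<longleftrightarrow> (\<exists>a \<in> univ M Act. \<exists>l. l2 = l @ a # l1) \<or> l1 = l2"
      (is "?L \<longleftrightarrow> ?R")
    proof
      assume ?L
      then obtain k where k: "l2 = k @ l1" by blast
      show ?R
      proof (cases k rule: rev_cases)
        \<comment> \<open>The last entry of \<open>k\<close> is the earliest additional action,
          hence the one performed in \<open>l1\<close>.\<close>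
        case (snoc k' a)
        then show ?thesis using k l(3) by auto
      qed (simp add: k)
    next
      assume ?R
      then show ?L by (metis append.left_neutral append.assoc append_Cons)
    qed
    then show "sat tree (Iff (preceq (svar 1) (svar 2))
      (Disj (Exists (Act, 0) (preceq (do_tm (avar 0) (svar 1)) (svar 2))) (Eq (svar 1) (svar 2)))) e"
      using l by (auto simp: inj avar_def svar_def preceq_def)
  qed
  moreover have "models tree {ForallR ([Sit], 0)
        (Imp (Conj (RelVar ([Sit], 0) [s0])
                   (Alls [(Act, 0), (Sit, 0)]
                      (Imp (RelVar ([Sit], 0) [svar 0])
                           (RelVar ([Sit], 0) [do_tm (avar 0) (svar 0)]))))
             (Forall (Sit, 0) (RelVar ([Sit], 0) [svar 0])))}"
  proof -
    have "Q [enc l]" if "Q [enc []]"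
      "\<And>a l. a \<in> univ M Act \<Longrightarrow> l \<in> lists (univ M Act) \<Longrightarrow> Q [enc l] \<Longrightarrow> Q [enc (a # l)]"
      "l \<in> lists (univ M Act)" for Q l
      using that(3) by (induction l rule: lists.induct) (auto intro: that)
    note ind = this
    show ?thesis
      by (clarsimp simp: models_def Alls_def avar_def svar_def) (rule ind; auto)
  qed
  ultimately show ?thesis
    unfolding foundational_def by - (rule modelsI, auto simp only: insert_iff empty_iff models_Alls models_Forall)
qed

text \<open>This is \<open>uniform_transfer\<close> with \<open>svar 0\<close> for both terms: at
  \<open>enc l\<close> the tree has the fluents that the snapshot has at every situation. Hence
  \<open>e'\<close> may assign any situation.\<close>

lemma tree_here:
  assumes e: "ival e (Sit, 0) = enc l"
    and \<phi>: "wf_fm \<phi>" "uniform (svar 0) \<phi>" "fv \<phi> \<subseteq> axiom_vars n"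
    and e': "IV (Act, 0) \<in> fv \<phi> \<Longrightarrow> ival e (Act, 0) = ival e' (Act, 0)" "\<And>i. i < n \<Longrightarrow> ival e (Obj, i) = ival e' (Obj, i)"
  shows "sat tree \<phi> e \<longleftrightarrow> sat (here l) \<phi> e'"
proof -
  have "sat tree \<phi> e \<longleftrightarrow> sat (here l) (repl_fm (svar 0) (svar 0) \<phi>) e'"
  proof (rule uniform_transfer)
    show "same_static tree (here l)"
      unfolding here_def using same_static_sym[OF same_static_tree]
      by (rule same_static_local)
    show "agree e e' v" if "v \<in> fv \<phi>" "nonsit v" for v
      using that \<phi>(3) e' by (auto simp: axiom_vars_def)
    show "proper_fv (fv \<phi>)" using \<phi>(3) by (rule proper_axiom_vars)
  qed (use e \<phi> in \<open>simp_all add: sit_term_def svar_def here_def\<close>)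
  then show ?thesis by (simp add: repl_fm_self)
qed

text \<open>The tree defines \<open>Poss\<close> through some representation of an action;
  uniqueness of that representation makes the definition match the precondition axioms.\<close>

lemma una_actions:
  assumes "FSym (Action A m) \<in> Sg" "FSym (Action B n) \<in> Sg"
    and xs: "xs \<in> tuples M (replicate m Obj)" and ys: "ys \<in> tuples M (replicate n Obj)"
    and eq: "fint M (Action A m) xs = fint M (Action B n) ys"
  shows "A = B \<and> m = n \<and> xs = ys"
proof -
  have len: "length xs = m" "length ys = n"
    and Obj: "set xs \<subseteq> univ M Obj" "set ys \<subseteq> univ M Obj"
    using xs ys by (auto simp: tuples_def list_all2_conv_all_nth in_set_conv_nth)
  obtain a where a: "a \<in> univ M Act" using M unfolding is_struct_def by blast
  \<comment> \<open>One assignment serves both sides of the axioms: the variables below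
    \<open>m\<close> get \<open>xs\<close>, those from \<open>m\<close> on get
    \<open>ys\<close>.\<close>
  define e where "e = env M (xs @ ys) a"
  have e: "is_assignment M e"
    unfolding e_def using Obj a by (intro is_assignment_env[OF M]) auto
  have vals: "map (tm_val M e) (ovars [0..<m]) = xs" "map (tm_val M e) (ovars [m..<m + n]) = ys"
    by (auto simp: ovars_def e_def env_def len nth_append intro!: nth_equalityI)
  have AB: "(A, m) = (B, n)"
  proof (rule ccontr)
    assume "(A, m) \<noteq> (B, n)"
    then have "Alls (map (Pair Obj) [0..<m + n])
        (Neg (Eq (Fun (Action A m) (ovars [0..<m])) (Fun (Action B n) (ovars [m..<m + n])))) \<in> una_axioms Sg"
      unfolding una_axioms_def using assms(1,2) by blast
    then have "models M {Neg (Eq (Fun (Action A m) (ovars [0..<m])) (Fun (Action B n) (ovars [m..<m + n])))}"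
      using modelsD[OF una] models_Alls by blast
    from models_sat[OF this e] show False using eq by (simp add: vals del: map_map)
  qed
  have "Alls (map (Pair Obj) [0..<n + n])
        (Imp (Eq (Fun (Action B n) (ovars [0..<n])) (Fun (Action B n) (ovars [n..<n + n])))
             (Conjs (map2 Eq (ovars [0..<n]) (ovars [n..<n + n])))) \<in> una_axioms Sg"
    unfolding una_axioms_def using assms(2) by blast
  then have "models M {Imp (Eq (Fun (Action B n) (ovars [0..<n])) (Fun (Action B n) (ovars [n..<n + n])))
             (Conjs (map2 Eq (ovars [0..<n]) (ovars [n..<n + n])))}"
    using modelsD[OF una] models_Alls by blast
  from models_sat[OF this e] have eqs: "\<forall>\<phi> \<in> set (map2 Eq (ovars [0..<n]) (ovars [n..<n + n])). sat M \<phi> e"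
    using eq vals AB by (simp add: Conjs_syntax)
  have "sat M (Eq (ovars [0..<n] ! i) (ovars [n..<n + n] ! i)) e" if "i < n" for i
    using bspec[OF eqs nth_mem[of i]] that by (simp add: ovars_def)
  then have "map (tm_val M e) (ovars [0..<n]) = map (tm_val M e) (ovars [n..<n + n])"
    by (intro nth_equalityI) (simp_all add: ovars_def)
  then show ?thesis using vals AB by simp
qed

lemma tree_ap:
  assumes A: "FSym (Action A n) \<in> Sg" and \<Pi>: "ap_condition n (\<Pi> A n)"
  shows "models tree {ap_axiom A n (\<Pi> A n)}"
  unfolding ap_axiom_def models_Alls unfolding models_def
proof clarify
  fix e assume e: "is_assignment tree e"
  define xs where "xs = map (\<lambda>i. ival e (Obj, i)) [0..<n]"
  define a where "a = fint M (Action A n) xs"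
  obtain l where l: "ival e (Sit, 0) = enc l" using tree_assignment(3)[OF e] by blast
  have xs: "xs \<in> tuples M (replicate n Obj)"
    using tree_assignment(1)[OF e] by (simp add: xs_def tuples_def list_all2_conv_all_nth)
  have vals: "map (tm_val tree e) (ovars [0..<n]) = xs"
    by (simp add: xs_def ovars_def comp_def)
  have "sat tree (Rel Poss [Fun (Action A n) (ovars [0..<n]), svar 0]) e \<longleftrightarrow>
      (\<exists>B m ys. FSym (Action B m) \<in> Sg \<and> ys \<in> tuples M (replicate m Obj) \<and>
        a = fint M (Action B m) ys \<and> sat (here l) (\<Pi> B m) (env M ys a))"
    by (simp add: vals a_def svar_def l del: map_map)
  also have "\<dots> \<longleftrightarrow> sat (here l) (\<Pi> A n) (env M xs a)"
    \<comment> \<open>The only representation of \<open>a\<close> is \<open>A\<close> applied to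
      \<open>xs\<close>, so the existential collapses.\<close>
    using una_actions[OF A _ xs] A xs unfolding a_def by blast
  \<comment> \<open>The action variable is not free in \<open>\<Pi> A n\<close>, so \<open>e\<close>
    may map it to something other than \<open>a\<close>.\<close>
  also have "\<dots> \<longleftrightarrow> sat tree (\<Pi> A n) e"
    using \<Pi> l by (intro tree_here[where n = n, symmetric])
      (auto simp: ap_condition_def axiom_vars_def env_def xs_def)
  finally show "sat tree (Iff (Rel Poss [Fun (Action A n) (ovars [0..<n]), svar 0]) (\<Pi> A n)) e"
    by (simp del: sat.simps(3))
qed

text \<open>The successor of \<open>enc l\<close> decodes to \<open>a # l\<close>, where the
  recursion equation of \<open>fluents_after\<close> is the axiom itself, read in the snapshot of
  \<open>l\<close>.\<close>

lemma tree_ss: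
  assumes G: "G F n = ss_rhs F n pos neg" and wf: "\<forall>E \<in> set pos \<union> set neg. wf_effect n E"
  shows "models tree {ss_axiom F n pos neg}"
  unfolding ss_axiom_def models_Alls ss_rhs_def[symmetric] unfolding models_def
proof clarify
  fix e assume e: "is_assignment tree e"
  define xs where "xs = map (\<lambda>i. ival e (Obj, i)) [0..<n]"
  obtain l where l: "ival e (Sit, 0) = enc l" using tree_assignment(3)[OF e] by blast
  have vals: "map (tm_val tree e) (ovars [0..<n]) = xs"
    by (simp add: xs_def ovars_def comp_def)
  have "sat tree (Rel (Fluent F n) (ovars [0..<n] @ [do_tm (avar 0) (svar 0)])) e \<longleftrightarrow>
      sat (here l) (ss_rhs F n pos neg) (env M xs (ival e (Act, 0)))"
    by (simp add: vals l avar_def svar_def here_def G del: map_map)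
  also have "\<dots> \<longleftrightarrow> sat tree (ss_rhs F n pos neg) e"
    by (rule tree_here[OF l ss_rhs_syntax[OF wf], symmetric]) (auto simp: env_def xs_def)
  finally show "sat tree (Iff (Rel (Fluent F n) (ovars [0..<n] @ [do_tm (avar 0) (svar 0)]))
      (ss_rhs F n pos neg)) e"
    by (simp del: sat.simps(3))
qed

end


section \<open>Progression and fluent-free consequences\<close>

text \<open>Only the fluents of \<open>M\<close> are free to change, which is what lets fluent-free
  consequences be pulled back to \<open>M\<close>.\<close>

lemma progression_backwards:
  fixes M :: "('n, 'u::infinite) struct"
  assumes bat: "basic_action_theory TYPE('u) Sg Duna DS0 Dap Dss"
    and una_sentences: "\<And>\<phi>. \<phi> \<in> Duna \<Longrightarrow> sentence \<phi>"
    and ground: "ground_action_term \<alpha>"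
    and prog: "is_progression TYPE('u) Duna DS0 Dap Dss \<alpha> DS\<alpha>"
    and model: "is_struct M" "models M (Duna \<union> DS0)"
  obtains X where "models (local_struct M X) (Duna \<union> repl_fm (do_tm \<alpha> s0) s0 ` DS\<alpha>)"
proof -
  let ?S = "do_tm \<alpha> s0"
  from bat have Duna: "Duna = una_axioms Sg" and DS0: "initial_theory TYPE('u) DS0"
    and Dap: "precondition_axioms Sg Dap" and Dss: "successor_state_axioms Sg Dss"
    by (simp_all add: basic_action_theory_def)
  obtain \<Pi> where \<Pi>: "\<And>A n. FSym (Action A n) \<in> Sg \<Longrightarrow> ap_condition n (\<Pi> A n)"
    "Dap = {ap_axiom A n (\<Pi> A n) | A n. FSym (Action A n) \<in> Sg}"
    using Dap by (auto simp: precondition_axioms_def)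
  obtain pos neg where
    eff: "\<And>F n. PSym (Fluent F n) \<in> Sg \<Longrightarrow>
      \<forall>E \<in> set (pos F n) \<union> set (neg F n). wf_effect n E"
    and ss: "Dss = {ss_axiom F n (pos F n) (neg F n) | F n. PSym (Fluent F n) \<in> Sg}"
    using Dss unfolding successor_state_axioms_def by blast
  obtain enc :: "'u list \<Rightarrow> 'u" where enc: "inj enc" using list_encoding by blast
  interpret situation_tree M enc Sg \<Pi> "\<lambda>F n. ss_rhs F n (pos F n) (neg F n)"
    using model enc by unfold_locales (simp_all add: models_union Duna)
  have una_ff: "PSym p \<notin> sig_fm \<phi>" if "\<phi> \<in> Duna" for p \<phi>
    using that unfolding Duna by (rule una_axioms_fluent_free)
  have s0: "sit_term (s0 :: 'n tm)" by (simp add: sit_term_def s0_def)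
  have S: "sit_term ?S" using ground
    by (simp add: sit_term_def do_tm_def s0_def ground_action_term_def)
  have "models tree {\<phi>}" if "\<phi> \<in> Dap" for \<phi>
    using that \<Pi> tree_ap by auto
  moreover have "models tree {\<phi>}" if "\<phi> \<in> Dss" for \<phi>
    using that eff tree_ss unfolding ss by blast
  moreover have "models tree {\<phi>}" if "\<phi> \<in> Duna" for \<phi>
  proof -
    have "models tree {repl_fm s0 s0 \<phi>}"
    proof (subst sentence_transfer[symmetric, OF same_static_tree model(1) is_struct_tree s0 s0])
      show "models M {\<phi>}" using model(2) that by (auto intro: modelsD)
      show "uniform s0 \<phi>" using that una_axioms_uniform by (simp add: Duna)
    qed (use that in \<open>simp_all add: una_sentences una_ff\<close>)
    then show ?thesis by (simp add: repl_fm_self)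
  qed
  \<comment> \<open>At \<open>enc []\<close> the tree has by definition the fluents of
    \<open>M\<close> at \<open>S0\<close>. Replacing \<open>s0\<close> by itself only serves to
    match \<open>sentence_transfer\<close>.\<close>
  moreover have "models tree {\<phi>}" if "\<phi> \<in> DS0" for \<phi>
  proof -
    have "models tree {repl_fm s0 s0 \<phi>}"
    proof (subst sentence_transfer[symmetric, OF same_static_tree model(1) is_struct_tree s0 s0])
      show "models M {\<phi>}" using model(2) that by (auto intro: modelsD)
      show "sentence \<phi>" "uniform s0 \<phi>" using that DS0 unfolding initial_theory_def by blast+
    qed (simp add: s0_def)
    then show ?thesis by (simp add: repl_fm_self)
  qed
  ultimately have "models tree Dap" "models tree Dss" "models tree Duna" "models tree DS0"
    by - (rule modelsI, blast)+
  \<comment> \<open>The tree models the whole action theory, so in the definition of progression it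
    is its own witness \<open>M'\<close>.\<close>
  moreover have "similar_at ?S tree tree" by (simp add: similar_at_def)
  ultimately have DS\<alpha>: "models tree DS\<alpha>"
    using prog is_struct_tree tree_foundational unfolding is_progression_def models_union by blast
  \<comment> \<open>As \<open>\<alpha>\<close> is ground, \<open>?S\<close> has the same value under
    all assignments, and any \<open>e0\<close> can be used to name it.\<close>
  obtain e0 where e0: "is_assignment tree e0" using ex_assignment[OF is_struct_tree] .
  define v where "v = tm_val tree e0 ?S"
  have v: "tm_val tree e ?S = v" for e
    unfolding v_def using ground
    by (intro tm_val_cong) (auto simp: do_tm_def s0_def ground_action_term_def)
  \<comment> \<open>The fluents of the tree at \<open>v\<close> are made to hold at every situation
    of \<open>M\<close>, in particular at \<open>s0\<close>.\<close>
  define X where "X = (\<lambda>F n ds. rint tree (Fluent F n) (ds @ [v]))"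
  have st: "same_static tree (local_struct M X)"
    using same_static_sym[OF same_static_tree] by (rule same_static_local)
  have "models (local_struct M X) {repl_fm ?S s0 \<phi>}" if "\<phi> \<in> DS\<alpha>" for \<phi>
  proof (subst sentence_transfer[symmetric, OF st is_struct_tree _ S s0])
    show "is_struct (local_struct M X)" using model(1) by (simp add: is_struct_local)
    show "sentence \<phi>" "uniform ?S \<phi>" using prog that by (simp_all add: is_progression_def)
    show "models tree {\<phi>}" using DS\<alpha> that by (rule modelsD)
    show "rint tree (Fluent F n) (ds @ [tm_val tree e ?S]) =
        rint (local_struct M X) (Fluent F n) (ds @ [tm_val (local_struct M X) e' s0])" for F n ds e e'
      unfolding v local_struct_simps by (simp only: X_def butlast_snoc)
  qed
  moreover have "models (local_struct M X) {\<phi>}" if "\<phi> \<in> Duna" for \<phi>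
  proof (subst local_struct_fluent_free)
    show "PSym (Fluent F n) \<notin> sig_fm \<phi>" for F n
      using that by (simp add: una_ff)
    show "models M {\<phi>}" using model(2) that by (auto intro: modelsD)
  qed
  ultimately have "models (local_struct M X) (Duna \<union> repl_fm ?S s0 ` DS\<alpha>)"
    by - (rule modelsI, blast)
  then show ?thesis by (rule that)
qed

text \<open>The model from \<open>progression_backwards\<close> differs from \<open>M\<close> in
  fluents only, and \<open>\<phi>\<close> mentions none.\<close>

lemma fluent_free_consequence:
  fixes DS0 :: "'n fm set"
  assumes bat: "basic_action_theory TYPE('u::infinite) Sg Duna DS0 Dap Dss"
    and una_sentences: "\<And>\<phi>. \<phi> \<in> Duna \<Longrightarrow> sentence \<phi>"
    and ground: "ground_action_term \<alpha>"
    and prog: "is_progression TYPE('u) Duna DS0 Dap Dss \<alpha> DS\<alpha>"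
    and \<phi>: "fluent_free (sig_fm \<phi>)"
    and ent: "entails TYPE('u) (Duna \<union> repl_fm (do_tm \<alpha> s0) s0 ` DS\<alpha>) \<phi>"
  shows "entails TYPE('u) (Duna \<union> DS0) \<phi>"
  unfolding entails_def
proof (intro allI impI)
  fix M :: "('n, 'u) struct"
  assume M: "is_struct M" "models M (Duna \<union> DS0)"
  obtain X where "models (local_struct M X) (Duna \<union> repl_fm (do_tm \<alpha> s0) s0 ` DS\<alpha>)"
    using progression_backwards[OF bat una_sentences ground prog M] by blast
  then have "models (local_struct M X) {\<phi>}"
    using ent M(1) by (simp add: entails_def is_struct_local)
  then show "models M {\<phi>}"
    using \<phi> by (simp add: local_struct_fluent_free fluent_free_def)
qed

text \<open>For infinite \<open>I\<close> interpolation is assumed for families in addition, since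
  iterating the property for pairs reaches only finite unions. Consequence refers to structures over
  an arbitrary infinite type.\<close>

theorem theorem4p4:
  fixes L Duna DS0 Dap Dss DS\<alpha> :: "'n fm set"
    and Sg \<sigma> \<Delta> :: "'n symbol set"
    and \<alpha> :: "'n tm"
    and I J :: "nat set"
    and D D' :: "nat \<Rightarrow> 'n fm set"
  assumes logic: "is_logic L"
    and pip: "has_PIP TYPE('u::infinite) L"
    and pip_infinite: "infinite I \<Longrightarrow> has_PIP_family TYPE('u) L I"
    and bat: "basic_action_theory TYPE('u) Sg Duna DS0 Dap Dss"
    and in_L: "DS0 \<subseteq> L" "Duna \<subseteq> L"
    and ground: "ground_action_term \<alpha>"
    and progression: "is_progression TYPE('u) Duna DS0 Dap Dss \<alpha> DS\<alpha>"
    and \<sigma>: "\<sigma> \<subseteq> sig DS0" "fluent_free \<sigma>"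
    and \<Delta>: "\<Delta> = sig Duna \<union> \<sigma>"
    and decomposition: "decomposable_with TYPE('u) L \<sigma> DS0 I D"
    and insep: "\<forall>i \<in> I. \<forall>j \<in> I. inseparable TYPE('u) L \<Delta> (Duna \<union> D i) (Duna \<union> D j)"
    and theories: "\<forall>j \<in> J. D' j \<subseteq> L"
    and equiv: "equivalent TYPE('u) (repl_fm (do_tm \<alpha> s0) s0 ` DS\<alpha>) (\<Union>j \<in> J. D' j)"
    and cons: "\<forall>j \<in> J. \<exists>i \<in> I.
        Consq TYPE('u) L (Duna \<union> D' j) \<Delta> \<supseteq> Consq TYPE('u) L (Duna \<union> D i) \<Delta>"
  shows "\<forall>i \<in> J. \<forall>j \<in> J. inseparable TYPE('u) L \<Delta> (Duna \<union> D' i) (Duna \<union> D' j)"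
proof -
  let ?Cn = "\<lambda>T. Consq TYPE('u) L (Duna \<union> T) \<Delta>"
  have una_sentences: "sentence \<phi>" if "\<phi> \<in> Duna" for \<phi>
    using that in_L logic by (auto simp: is_logic_def)
  have "Duna = una_axioms Sg" using bat unfolding basic_action_theory_def by blast
  then have "PSym p \<notin> sig Duna" for p
    using una_axioms_fluent_free unfolding sig_def by blast
  then have \<Delta>_ff: "fluent_free \<Delta>"
    using \<sigma>(2) by (simp add: fluent_free_def \<Delta>)
  have D: "\<And>i. i \<in> I \<Longrightarrow> D i \<subseteq> L"
    "\<And>i j. i \<in> I \<Longrightarrow> j \<in> I \<Longrightarrow> i \<noteq> j \<Longrightarrow> sig (D i) \<inter> sig (D j) = \<sigma>"
    and DS0: "equivalent TYPE('u) DS0 (\<Union>i \<in> I. D i)"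
    using decomposition by (simp_all add: decomposable_with_def)
  have initial: "\<phi> \<in> ?Cn (D i)" if i: "i \<in> I" and \<phi>: "\<phi> \<in> ?Cn DS0" for i \<phi>
  proof -
    let ?T = "\<lambda>k. Duna \<union> D k"
    have "entails TYPE('u) (Duna \<union> DS0) \<phi>" using \<phi> by (simp add: Consq_def)
    \<comment> \<open>The index \<open>i\<close> shows that \<open>I\<close> is nonempty; over an
      empty \<open>I\<close> the union would lose \<open>Duna\<close>.\<close>
    then have ent: "entails TYPE('u) (\<Union>k \<in> I. ?T k) \<phi>"
      using DS0 i unfolding entails_def equivalent_def models_union models_UN by blast
    have T: "?T k \<subseteq> L" if "k \<in> I" for k using that D(1) in_L by simp
    \<comment> \<open>Adding \<open>Duna\<close> to every component enlarges the common signature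
      from \<open>\<sigma>\<close> to exactly \<open>\<Delta>\<close>.\<close>
    have sigs: "sig (?T k) \<inter> sig (?T j) = \<Delta>" if "k \<in> I" "j \<in> I" "k \<noteq> j" for k j
      using D(2)[OF that] by (auto simp: sig_Un \<Delta>)
    \<comment> \<open>By inseparability the consequences of the single component \<open>D i\<close>
      can play the role of \<open>C\<close> for all components.\<close>
    have C: "Consq TYPE('u) L (?T k) \<Delta> \<subseteq> ?Cn (D i)" if "k \<in> I" for k
      using that i insep unfolding inseparable_def by blast
    have L: "\<phi> \<in> L" "sig_fm \<phi> \<subseteq> \<Delta>" using \<phi> by (simp_all add: Consq_def)
    have "entails TYPE('u) (?Cn (D i)) \<phi>"
    proof (cases "finite I")
      case True
      then show ?thesis
        by (rule interpolation_finite[OF pip _ T _ C L ent]) (simp_all add: sigs)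
    next
      case False
      then show ?thesis
        by (rule interpolation_family[OF pip_infinite T sigs C L ent])
    qed
    then have "entails TYPE('u) (Duna \<union> D i) \<phi>" by (rule entails_cut[OF entails_Consq])
    then show ?thesis using L by (simp add: Consq_def)
  qed
  \<comment> \<open>The chain runs from \<open>D' j\<close> through the progression back to
    \<open>DS0\<close>, from there to a component \<open>D i\<close>, and by \<open>cons\<close> to
    \<open>D' k\<close>. Inclusions for all ordered pairs give equality.\<close>
  have "?Cn (D' j) \<subseteq> ?Cn (D' k)" if j: "j \<in> J" and k: "k \<in> J" for j k
  proof
    fix \<phi> assume \<phi>: "\<phi> \<in> ?Cn (D' j)"
    obtain i where i: "i \<in> I" "?Cn (D i) \<subseteq> ?Cn (D' k)" using cons k by blast
    have "entails TYPE('u) (Duna \<union> D' j) \<phi>" using \<phi> by (simp add: Consq_def)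
    then have "entails TYPE('u) (Duna \<union> repl_fm (do_tm \<alpha> s0) s0 ` DS\<alpha>) \<phi>"
      using equiv j unfolding entails_def equivalent_def models_union models_UN by blast
    moreover have "fluent_free (sig_fm \<phi>)"
      using \<phi> \<Delta>_ff unfolding Consq_def fluent_free_def by blast
    ultimately have "entails TYPE('u) (Duna \<union> DS0) \<phi>"
      using fluent_free_consequence[OF bat una_sentences ground progression] by blast
    then have "\<phi> \<in> ?Cn DS0" using \<phi> by (simp add: Consq_def)
    then show "\<phi> \<in> ?Cn (D' k)" using initial i by blast
  qed
  then show ?thesis unfolding inseparable_def by blast
qed

end
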